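(* Let $\widetilde Q=\|q_{ik}\|$ be a $\widetilde Q$-matrix, let $\widetilde P=\|p_{ik}\|$ ($i\in\mathbf N_k$, $k\in\mathbb N$) satisfy $p_{ik}\ge 0$ and $\sum_{i\in\mathbf N_k}p_{ik}=1$ for each $k$, and let $\mu_\xi$ be the distribution of the random variable $\xi=\Delta^{\widetilde Q}_{\xi_1\xi_2\dots\xi_k\dots}$, where $(\xi_k)_{k\in\mathbb N}$ are independent with $P(\xi_k=i)=p_{ik}$ for $i\in\mathbf N_k$. Put $$\rho:=\prod_{k=1}^\infty\Big\{\sum_{i\in\mathbf N_k}\sqrt{p_{ik}\,q_{ik}}\Big\},\qquad P_{\max}:=\prod_{k=1}^\infty\max_{i\in\mathbf N_k}\{p_{ik}\}.$$ Then the measure $\mu_\xi$ is of pure type, i.e. it is either purely absolutely continuous, or purely point, or purely singular continuous (with respect to Lebesgue measure). Precisely: 1) $\mu_\xi$ is purely absolutely continuous if and only if $\rho>0$; 2) $\mu_\xi$ is purely point if and only if $P_{\max}>0$; 3) $\mu_\xi$ is purely singular continuous if and only if $\rho=0=P_{\max}$.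
   Context: $\widetilde Q$-matrix: for each $k\in\mathbb N=\{1,2,\dots\}$ let $0<N_k\le\infty$ and $\mathbf N_k=\{0,1,\dots,N_k\}$ if $N_k<\infty$, $\mathbf N_k=\{0,1,2,\dots\}$ if $N_k=\infty$. A $\widetilde Q$-matrix is a family $q_{ik}$ ($i\in\mathbf N_k$, $k\in\mathbb N$) with $q_{ik}>0$, $\sum_{i\in\mathbf N_k}q_{ik}=1$ for each $k$, and $\prod_{k=1}^\infty\max_{i\in\mathbf N_k}q_{ik}=0$. Intervals: $[0,1]$ is decomposed from left to right into closed intervals $\Delta^{\widetilde Q}_{i_1}$, $i_1\in\mathbf N_1$, without common interior points, of length $q_{i_11}$; that is, $\Delta^{\widetilde Q}_{i_1}=[\sum_{j<i_1}q_{j1},\sum_{j\le i_1}q_{j1}]$. Inductively each $\Delta^{\widetilde Q}_{i_1\dots i_{k-1}}$ is decomposed from left to right, in increasing order of $i_k\in\mathbf N_k$, into closed intervals $\Delta^{\widetilde Q}_{i_1\dots i_k}$ without common interior points, of length $\prod_{s=1}^k q_{i_ss}$. For a sequence $(i_k)$ with $i_k\in\mathbf N_k$, $\Delta^{\widetilde Q}_{i_1i_2\dots i_k\dots}$ denotes the unique point of $\bigcap_{k}\Delta^{\widetilde Q}_{i_1\dots i_k}$; equivalently, it is the number $\sum_{k=1}^\infty\big(\sum_{j<i_k}q_{jk}\big)\prod_{s=1}^{k-1}q_{i_ss}$ (empty sums are $0$, empty products are $1$). "Purely point" means concentrated on an at most countable set; "singular continuous" means atomless and singular with respect to Lebesgue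 measure. *)

theory Defs
  imports "HOL-Probability.Probability"
begin

text \<open>
  Columns are indexed by \<open>k \<ge> 1\<close>; values of families at \<open>k = 0\<close> are never used.
\<close>

definition digits :: "(nat \<Rightarrow> enat) \<Rightarrow> nat \<Rightarrow> nat set" where
  "digits N k = {i. enat i \<le> N k}"

text \<open>
  The digit sets may be infinite, so \<^const>\<open>Max\<close> is not applicable. For nonnegative families with
  sum 1 the maximum is attained, so this greatest value exists.
\<close>

definition col_max :: "nat set \<Rightarrow> (nat \<Rightarrow> real) \<Rightarrow> real" where
  "col_max A f = (GREATEST x. x \<in> f ` A)"

text \<open>
  The limit of the partial products. The library's \<^const>\<open>prodinf\<close> is unsuitable, since it does not
  assign the value 0 to a product of nonzero factors whose partial products tend to 0.
  All products below have factors in \<open>[0,1]\<close>, so the limit exists.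
\<close>

definition inf_product :: "(nat \<Rightarrow> real) \<Rightarrow> real" where
  "inf_product f = lim (\<lambda>n. \<Prod>k=1..n. f k)"

definition Q_matrix :: "(nat \<Rightarrow> enat) \<Rightarrow> (nat \<Rightarrow> nat \<Rightarrow> real) \<Rightarrow> bool" where
  "Q_matrix N q \<longleftrightarrow>
     (\<forall>k\<ge>1. 0 < N k) \<and>
     (\<forall>k\<ge>1. \<forall>i\<in>digits N k. q i k > 0) \<and>
     (\<forall>k\<ge>1. ((\<lambda>i. q i k) has_sum 1) (digits N k)) \<and>
     inf_product (\<lambda>k. col_max (digits N k) (\<lambda>i. q i k)) = 0"

text \<open>
  Left endpoint of the interval of rank \<open>k\<close> given by the digits \<open>i 1, \<dots>, i k\<close>: the subintervals of
  an interval of rank \<open>k\<close> with digits \<open>j < i (k+1)\<close> lie to the left of the one with digit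
  \<open>i (k+1)\<close>, and have lengths \<open>q j (k+1)\<close> relative to their parent.
\<close>

primrec cyl_left :: "(nat \<Rightarrow> nat \<Rightarrow> real) \<Rightarrow> (nat \<Rightarrow> nat) \<Rightarrow> nat \<Rightarrow> real" where
  "cyl_left q i 0 = 0"
| "cyl_left q i (Suc k) =
     cyl_left q i k + (\<Sum>j<i (Suc k). q j (Suc k)) * (\<Prod>s=1..k. q (i s) s)"

definition cylinder :: "(nat \<Rightarrow> nat \<Rightarrow> real) \<Rightarrow> (nat \<Rightarrow> nat) \<Rightarrow> nat \<Rightarrow> real set" where
  "cylinder q i k = {cyl_left q i k .. cyl_left q i k + (\<Prod>s=1..k. q (i s) s)}"

definition Delta :: "(nat \<Rightarrow> nat \<Rightarrow> real) \<Rightarrow> (nat \<Rightarrow> nat) \<Rightarrow> real" where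
  "Delta q i = (THE x. x \<in> (\<Inter>k\<in>{1..}. cylinder q i k))"

definition purely_abs_continuous :: "real measure \<Rightarrow> bool" where
  "purely_abs_continuous \<mu> \<longleftrightarrow> absolutely_continuous lborel \<mu>"

definition purely_point :: "real measure \<Rightarrow> bool" where
  "purely_point \<mu> \<longleftrightarrow> (\<exists>C. countable C \<and> emeasure \<mu> (UNIV - C) = 0)"

definition purely_singular_continuous :: "real measure \<Rightarrow> bool" where
  "purely_singular_continuous \<mu> \<longleftrightarrow>
     (\<forall>x. emeasure \<mu> {x} = 0) \<and>
     (\<exists>A\<in>sets borel. emeasure lborel A = 0 \<and> emeasure \<mu> (UNIV - A) = 0)"

text \<open>
  The three types are mutually exclusive for probability measures on the Borel sets.
\<close>

lemma pure_types_exclusive: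
  assumes "prob_space \<mu>" and sets: "sets \<mu> = sets borel"
  shows "\<not> (purely_abs_continuous \<mu> \<and> purely_point \<mu>)"
    and "\<not> (purely_abs_continuous \<mu> \<and> purely_singular_continuous \<mu>)"
    and "\<not> (purely_point \<mu> \<and> purely_singular_continuous \<mu>)"
proof -
  interpret prob_space \<mu> by fact
  have sp: "space \<mu> = UNIV"
    using sets_eq_imp_space_eq[OF sets] by simp
  have split: False
    if "A \<in> sets borel" "emeasure \<mu> A = 0" "emeasure \<mu> (UNIV - A) = 0" for A
  proof -
    have "A \<in> null_sets \<mu>" "UNIV - A \<in> null_sets \<mu>"
      using that sets by (auto simp: null_sets_def)
    then have "A \<union> (UNIV - A) \<in> null_sets \<mu>"
      by (rule null_sets.Un)
    then show False
      using emeasure_space_1 sp by (simp add: null_sets_def)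
  qed
  have ac: "emeasure \<mu> A = 0"
    if "purely_abs_continuous \<mu>" "A \<in> sets borel" "emeasure lborel A = 0" for A
    using that by (auto simp: purely_abs_continuous_def absolutely_continuous_def null_sets_def)
  have borel: "C \<in> sets borel" if "countable C" for C :: "real set"
    using that by (rule sets.countable[rotated]) auto
  show "\<not> (purely_abs_continuous \<mu> \<and> purely_point \<mu>)"
    using ac split borel countable_imp_null_set_lborel
    unfolding purely_point_def null_sets_def by blast
  show "\<not> (purely_abs_continuous \<mu> \<and> purely_singular_continuous \<mu>)"
    using ac split unfolding purely_singular_continuous_def by blast
  show "\<not> (purely_point \<mu> \<and> purely_singular_continuous \<mu>)"
  proof
    assume "purely_point \<mu> \<and> purely_singular_continuous \<mu>"
    then obtain C where C: "countable C" "emeasure \<mu> (UNIV - C) = 0"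
      and x: "\<And>x. emeasure \<mu> {x} = 0"
      unfolding purely_point_def purely_singular_continuous_def by blast
    have "(\<Union>x\<in>C. {x}) \<in> null_sets \<mu>"
      using C(1) x sets by (intro null_sets_UN') (auto simp: null_sets_def)
    then have "emeasure \<mu> C = 0"
      by (simp add: null_sets_def)
    then show False
      using split borel C by blast
  qed
qed

end

theory Submission
  imports Defs
begin

text \<open>
  The digits \<open>\<xi>\<^sub>k\<close> are independent, so the question is how the product of the digit laws
  \<open>p\<^sub>k\<close> compares with the product of the laws \<open>q\<^sub>k\<close>, under which the random number is
  uniformly distributed. This is Kakutani's dichotomy, and \<open>\<rho>\<close> is the Hellinger affinity of the
  two products. It is proved here on finite words only: a word of length \<open>n\<close> has a weight for \<open>q\<close>,
  which is the length of its cylinder, and a weight for \<open>p\<close>, which is the probability that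
  the random number starts with that word; the affinity of the two weights is the partial product of
  \<open>\<rho>\<close>. Since a random number lies in the cylinders of its own digits, sets of words turn into
  sets of reals without inverting the expansion, which is ambiguous at endpoints.

  If \<open>\<rho> = 0\<close>, the words with \<open>p\<close>-weight at least the \<open>q\<close>-weight have small total length
  but carry almost all probability (\<open>affinity_separates\<close>, \<open>nearly_singular\<close>), and Borel--Cantelli
  gives singularity (\<open>singular_if_nearly_singular\<close>).

  If \<open>\<rho> > 0\<close>, then the Cauchy--Schwarz inequality (\<open>affinity_le\<close>) shows that words of small
  total length carry probability at most about \<open>1 - r\<^sup>2\<close>, where \<open>r\<close> is the affinity. Covering a
  Lebesgue null set by a small open set, which is exhausted by cylinders, bounds its probability
  by \<open>1 - r\<^sup>2\<close>. The same holds conditionally on the first \<open>m\<close> digits, with the affinity of the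
  remaining digits (\<open>prob_prefix_null_le\<close>); as \<open>m\<close> grows, that affinity tends to 1 and the
  bound to 0 (\<open>prob_null_set\<close>).

  A point lies in at most two cylinders of each rank, so \<open>P\<^sub>m\<^sub>a\<^sub>x = 0\<close> excludes atoms
  (\<open>prob_point_le\<close>). If \<open>P\<^sub>m\<^sub>a\<^sub>x > 0\<close>, almost surely only finitely many digits differ from the
  most probable ones, which leaves countably many values (\<open>countably_many_values\<close>).
  The equivalences follow because the three types exclude each other.
\<close>

section \<open>Infinite sums and products of nonnegative reals\<close>

lemma has_sum_prod_PiE_nonneg:
  fixes f :: "'i \<Rightarrow> 'b::countable \<Rightarrow> real"
  assumes fin: "finite I"
    and nonneg: "\<And>k x. k \<in> I \<Longrightarrow> x \<in> B k \<Longrightarrow> 0 \<le> f k x"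
    and sums: "\<And>k. k \<in> I \<Longrightarrow> (f k has_sum s k) (B k)"
  shows "((\<lambda>v. \<Prod>k\<in>I. f k (v k)) has_sum (\<Prod>k\<in>I. s k)) (PiE I B)"
proof -
  have abs: "Infinite_Sum.abs_summable_on (f k) (B k)" if "k \<in> I" for k
    using has_sum_imp_summable[OF sums[OF that]]
    by (subst (asm) summable_on_iff_abs_summable_on_real)
  have "Infinite_Set_Sum.abs_summable_on (\<lambda>v. \<Prod>k\<in>I. f k (v k)) (PiE I B)"
    using fin abs by (intro abs_summable_on_prod_PiE) (auto simp flip: abs_summable_equivalent)
  then have "(\<lambda>v. \<Prod>k\<in>I. f k (v k)) summable_on PiE I B"
    by (subst summable_on_iff_abs_summable_on_real) (simp only: abs_summable_equivalent)
  moreover have "infsum (\<lambda>v. \<Prod>k\<in>I. f k (v k)) (PiE I B) = (\<Prod>k\<in>I. infsum (f k) (B k))"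
    using fin abs by (rule infsum_prod_PiE_abs)
  moreover have "(\<Prod>k\<in>I. infsum (f k) (B k)) = (\<Prod>k\<in>I. s k)"
    using sums by (intro prod.cong) (auto simp: infsumI)
  ultimately show ?thesis
    by (simp add: has_sum_iff)
qed

lemma infsum_Cauchy_Schwarz:
  fixes a b :: "'b \<Rightarrow> real"
  assumes a: "a summable_on C" "\<And>x. x \<in> C \<Longrightarrow> 0 \<le> a x"
    and b: "b summable_on C" "\<And>x. x \<in> C \<Longrightarrow> 0 \<le> b x"
  shows "(\<lambda>x. sqrt (a x * b x)) summable_on C"
    and "(\<Sum>\<^sub>\<infinity>x\<in>C. sqrt (a x * b x)) \<le> sqrt (infsum a C) * sqrt (infsum b C)"
proof -
  have fin: "(\<Sum>x\<in>F. sqrt (a x * b x)) \<le> sqrt (infsum a C) * sqrt (infsum b C)"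
    if F: "finite F" "F \<subseteq> C" for F
  proof -
    have "(\<Sum>x\<in>F. sqrt (a x * b x)) = (\<Sum>x\<in>F. \<bar>sqrt (a x)\<bar> * \<bar>sqrt (b x)\<bar>)"
      using F a b by (intro sum.cong) (auto simp: real_sqrt_mult subset_iff)
    also have "\<dots> \<le> L2_set (\<lambda>x. sqrt (a x)) F * L2_set (\<lambda>x. sqrt (b x)) F"
      by (rule L2_set_mult_ineq)
    also have "\<dots> = sqrt (sum a F) * sqrt (sum b F)"
      using F a b unfolding L2_set_def
      by (intro arg_cong2[where f="(*)"] arg_cong[where f=sqrt] sum.cong) (auto simp: subset_iff)
    also have "\<dots> \<le> sqrt (infsum a C) * sqrt (infsum b C)"
      using F a b by (intro mult_mono real_sqrt_le_mono finite_sum_le_infsum)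
        (auto intro!: sum_nonneg infsum_nonneg)
    finally show ?thesis .
  qed
  show sm: "(\<lambda>x. sqrt (a x * b x)) summable_on C"
    using a b fin by (intro nonneg_bdd_above_summable_on bdd_aboveI) auto
  show "(\<Sum>\<^sub>\<infinity>x\<in>C. sqrt (a x * b x)) \<le> sqrt (infsum a C) * sqrt (infsum b C)"
    using sm fin by (rule infsum_le_finite_sums)
qed

text \<open>
  Only finitely many entries of a summable family reach a given positive entry, so the
  maximum is one over a finite set.
\<close>

lemma col_max_attained:
  assumes nonneg: "\<And>i. i \<in> A \<Longrightarrow> 0 \<le> f i" and sum: "(f has_sum 1) A"
  obtains i where "i \<in> A" "f i = col_max A f" "\<And>j. j \<in> A \<Longrightarrow> f j \<le> col_max A f"
proof -
  have "\<exists>i\<in>A. f i > 0"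
  proof (rule ccontr)
    assume "\<not> ?thesis"
    then have "(f has_sum 0) A"
      using nonneg by (intro has_sum_0) (auto simp: not_less intro: antisym)
    then show False
      using sum has_sum_unique by fastforce
  qed
  then obtain i0 where i0: "i0 \<in> A" "f i0 > 0" by blast
  define B where "B = {i \<in> A. f i0 \<le> f i}"
  have "finite B"
  proof (rule ccontr)
    assume "infinite B"
    obtain n :: nat where n: "real n * f i0 > 1"
      using i0(2) reals_Archimedean3 by blast
    obtain F where F: "F \<subseteq> B" "finite F" "card F = n"
      using infinite_arbitrarily_large[OF \<open>infinite B\<close>] by blast
    have "real n * f i0 = (\<Sum>i\<in>F. f i0)" using F by simp
    also have "\<dots> \<le> sum f F" using F by (intro sum_mono) (auto simp: B_def)
    also have "\<dots> \<le> 1"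
      using F sum nonneg by (intro finite_sum_le_has_sum[OF sum]) (auto simp: B_def)
    finally show False using n by simp
  qed
  moreover have "i0 \<in> B" using i0 by (simp add: B_def)
  ultimately have "Max (f ` B) \<in> f ` B"
    by (intro Max_in) auto
  then obtain i where "i \<in> B" and fi: "f i = Max (f ` B)"
    by fastforce
  then have i: "i \<in> B" "\<And>j. j \<in> B \<Longrightarrow> f j \<le> f i"
    using \<open>finite B\<close> by (auto simp: fi)
  have max: "f j \<le> f i" if "j \<in> A" for j
    using that i i0 by (cases "j \<in> B") (force simp: B_def)+
  have "col_max A f = f i"
    unfolding col_max_def using i max by (intro Greatest_equality) (auto simp: B_def)
  then show thesis
    using that i max by (auto simp: B_def)
qed

lemma has_sum_one_le_one:
  fixes f :: "'b \<Rightarrow> real"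
  assumes "\<And>j. j \<in> A \<Longrightarrow> 0 \<le> f j" "(f has_sum 1) A" "i \<in> A"
  shows "f i \<le> 1"
  using finite_sum_le_has_sum[OF assms(2), of "{i}"] assms by auto

lemma inf_product_lim:
  assumes f: "\<And>k. 1 \<le> k \<Longrightarrow> 0 \<le> f k \<and> f k \<le> 1"
  shows "(\<lambda>n. \<Prod>k=1..n. f k) \<longlonglongrightarrow> inf_product f"
    and "inf_product f \<le> (\<Prod>k=1..n. f k)"
    and "0 \<le> inf_product f"
proof -
  have nonneg: "0 \<le> (\<Prod>k=1..n. f k)" for n
    using f by (intro prod_nonneg) auto
  have dec: "decseq (\<lambda>n. \<Prod>k=1..n. f k)"
    using f nonneg by (intro decseq_SucI) (auto intro!: mult_left_le)
  obtain L where L: "(\<lambda>n. \<Prod>k=1..n. f k) \<longlonglongrightarrow> L" "\<And>n. L \<le> (\<Prod>k=1..n. f k)"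
    using decseq_convergent[OF dec, of 0] nonneg by blast
  have eq: "inf_product f = L"
    unfolding inf_product_def using L(1) by (rule limI)
  show "(\<lambda>n. \<Prod>k=1..n. f k) \<longlonglongrightarrow> inf_product f" "inf_product f \<le> (\<Prod>k=1..n. f k)"
    using L eq by auto
  then show "0 \<le> inf_product f"
    using nonneg by (intro LIMSEQ_le_const) auto
qed

text \<open>
  The quotient \<open>r m\<close> is the product of all factors after the \<open>m\<close>-th one; it tends to 1 because
  a positive limit of the partial products cancels against itself.
\<close>

lemma inf_product_tail:
  assumes f: "\<And>k. 1 \<le> k \<Longrightarrow> 0 \<le> f k \<and> f k \<le> 1" and pos: "0 < inf_product f"
  defines "r \<equiv> \<lambda>m. inf_product f / (\<Prod>k=1..m. f k)"
  shows "r \<longlonglongrightarrow> 1" and "0 < r m" and "m \<le> n \<Longrightarrow> r m \<le> (\<Prod>k\<in>{m<..n}. f k)"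
proof -
  have le: "inf_product f \<le> (\<Prod>k=1..n. f k)" for n
    using f by (rule inf_product_lim)
  then have ppos: "0 < (\<Prod>k=1..n. f k)" for n
    using pos by (rule less_le_trans[rotated])
  have "(\<lambda>m. inf_product f / (\<Prod>k=1..m. f k)) \<longlonglongrightarrow> inf_product f / inf_product f"
    using pos f by (intro tendsto_intros inf_product_lim) auto
  then show "r \<longlonglongrightarrow> 1" using pos by (simp add: r_def)
  show "0 < r m" using pos ppos by (simp add: r_def)
  assume "m \<le> n"
  then have "{1..n} = {1..m} \<union> {m<..n}" by auto
  then have "(\<Prod>k=1..n. f k) = (\<Prod>k=1..m. f k) * (\<Prod>k\<in>{m<..n}. f k)"
    by (simp only:) (intro prod.union_disjoint; auto)
  then show "r m \<le> (\<Prod>k\<in>{m<..n}. f k)"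
    using le[of n] ppos[of m] by (simp add: r_def divide_le_eq mult.commute)
qed

section \<open>Countable unions and singularity\<close>

lemma nn_integral_count_space_infsum:
  fixes f :: "'b \<Rightarrow> real"
  assumes sm: "f summable_on D" and nonneg: "\<And>x. x \<in> D \<Longrightarrow> 0 \<le> f x"
  shows "(\<integral>\<^sup>+x. ennreal (f x) \<partial>count_space D) = ennreal (infsum f D)"
proof -
  have "Infinite_Set_Sum.abs_summable_on f D"
    using sm unfolding abs_summable_equivalent[symmetric]
    by (subst (asm) summable_on_iff_abs_summable_on_real)
  then show ?thesis
    using nonneg by (simp add: nn_integral_conv_infsetsum infsetsum_infsum)
qed

lemma (in finite_measure) has_sum_measure_disjoint_UN:
  assumes X: "\<And>i. i \<in> D \<Longrightarrow> X i \<in> sets M" and D: "countable D"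
    and disj: "disjoint_family_on X D"
  shows "((\<lambda>i. measure M (X i)) has_sum measure M (\<Union>i\<in>D. X i)) D"
proof -
  have "(\<integral>\<^sup>+i. ennreal (measure M (X i)) \<partial>count_space D) = emeasure M (\<Union>i\<in>D. X i)"
    using emeasure_UN_countable[OF X D disj] by (simp add: emeasure_eq_measure)
  then have "has_bochner_integral (count_space D) (\<lambda>i. measure M (X i)) (measure M (\<Union>i\<in>D. X i))"
    by (intro has_bochner_integral_nn_integral) (auto simp: emeasure_eq_measure)
  then have "Infinite_Set_Sum.abs_summable_on (\<lambda>i. measure M (X i)) D"
    and "infsetsum (\<lambda>i. measure M (X i)) D = measure M (\<Union>i\<in>D. X i)"
    unfolding infsetsum_def abs_summable_on_def by (auto simp: has_bochner_integral_iff)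
  then show ?thesis
    unfolding has_sum_iff
    by (subst summable_on_iff_abs_summable_on_real)
       (simp only: abs_summable_equivalent infsetsum_infsum)
qed

text \<open>
  Take sets that separate the two measures up to \<open>2\<^sup>-\<^sup>j\<close>. By Borel--Cantelli, applied to the sets in
  Lebesgue measure and to their complements in the other measure, their limit superior
  separates the measures exactly.
\<close>

lemma singular_if_nearly_singular:
  fixes \<mu> :: "real measure"
  assumes "finite_measure \<mu>" and sets: "sets \<mu> = sets borel"
    and near: "\<And>e::real. 0 < e \<Longrightarrow> \<exists>A\<in>sets borel.
      emeasure lborel A \<le> ennreal e \<and> emeasure \<mu> (UNIV - A) \<le> ennreal e"
  shows "\<exists>A\<in>sets borel. emeasure lborel A = 0 \<and> emeasure \<mu> (UNIV - A) = 0"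
proof -
  interpret finite_measure \<mu> by fact
  have sp: "space \<mu> = UNIV"
    using sets_eq_imp_space_eq[OF sets] by simp
  have "\<forall>j::nat. \<exists>A\<in>sets borel. emeasure lborel A \<le> ennreal ((1/2)^j) \<and>
      emeasure \<mu> (UNIV - A) \<le> ennreal ((1/2)^j)"
    using near by simp
  then obtain A :: "nat \<Rightarrow> real set" where A: "A j \<in> sets borel"
      "emeasure lborel (A j) \<le> ennreal ((1/2)^j)" "emeasure \<mu> (UNIV - A j) \<le> ennreal ((1/2)^j)"
    for j by metis
  have geo: "summable (\<lambda>j. (1/2::real)^j)" by (rule summable_geometric) simp
  have "limsup A \<in> null_sets lborel"
  proof (rule borel_cantelli_limsup1)
    show "emeasure lborel (A j) < \<infinity>" for j
      using A(2)[of j] by (simp add: le_less_trans)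
    show "summable (\<lambda>j. measure lborel (A j))"
      using A(2) by (intro summable_comparison_test'[OF geo, of 0])
        (simp add: measure_def enn2real_leI)
  qed (use A in auto)
  moreover have "limsup (\<lambda>j. UNIV - A j) \<in> null_sets \<mu>"
  proof (rule borel_cantelli_limsup1)
    show "summable (\<lambda>j. measure \<mu> (UNIV - A j))"
      using A(3) by (intro summable_comparison_test'[OF geo, of 0])
        (simp add: measure_def enn2real_leI)
  qed (use A sets in \<open>auto simp: less_top[symmetric]\<close>)
  moreover have "UNIV - limsup A \<subseteq> limsup (\<lambda>j. UNIV - A j)"
    by (auto simp: limsup_INF_SUP) (metis atLeast_iff linear)
  ultimately show ?thesis
    using sets A(1)
    by (intro bexI[of _ "limsup A"] conjI)
       (auto simp: null_sets_def intro: order.antisym dest!: emeasure_mono[of _ _ \<mu>])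
qed

section \<open>Geometry of the cylinders\<close>

locale Q_digits =
  fixes N :: "nat \<Rightarrow> enat" and q :: "nat \<Rightarrow> nat \<Rightarrow> real"
  assumes Q: "Q_matrix N q"
begin

abbreviation cyl_len :: "(nat \<Rightarrow> nat) \<Rightarrow> nat \<Rightarrow> real" where
  "cyl_len i n \<equiv> \<Prod>s=1..n. q (i s) s"

abbreviation word :: "nat \<Rightarrow> (nat \<Rightarrow> nat) \<Rightarrow> bool" where
  "word n i \<equiv> \<forall>k\<in>{1..n}. i k \<in> digits N k"

lemma q_pos: "1 \<le> k \<Longrightarrow> i \<in> digits N k \<Longrightarrow> 0 < q i k"
  using Q by (simp add: Q_matrix_def)

lemma q_sum: "1 \<le> k \<Longrightarrow> ((\<lambda>i. q i k) has_sum 1) (digits N k)"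
  using Q by (simp add: Q_matrix_def)

lemma digits_downward: "i \<in> digits N k \<Longrightarrow> j \<le> i \<Longrightarrow> j \<in> digits N k"
  unfolding digits_def by (auto intro: order.trans[of "enat j" "enat i"])

lemma q_partial_sums:
  assumes "1 \<le> k" "i \<in> digits N k"
  shows "0 \<le> (\<Sum>j<i. q j k)" and "(\<Sum>j<i. q j k) + q i k \<le> 1"
proof -
  have j: "j \<in> digits N k" if "j \<le> i" for j
    using digits_downward assms that by blast
  show "0 \<le> (\<Sum>j<i. q j k)"
    using q_pos j assms by (intro sum_nonneg) (simp add: less_imp_le)
  have "(\<Sum>j\<le>i. q j k) \<le> 1"
    using j q_pos assms by (intro finite_sum_le_has_sum[OF q_sum]) (auto simp: less_imp_le)
  then show "(\<Sum>j<i. q j k) + q i k \<le> 1"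
    by (simp flip: lessThan_Suc_atMost)
qed

lemma cyl_len_pos: "word n i \<Longrightarrow> 0 < cyl_len i n"
  by (intro prod_pos) (simp add: q_pos)

lemma cyl_cong:
  assumes "\<And>k. k \<in> {1..n} \<Longrightarrow> i k = j k"
  shows "cyl_left q i n = cyl_left q j n" and "cyl_len i n = cyl_len j n"
proof -
  have len: "cyl_len i n = cyl_len j n" if "\<And>k. k \<in> {1..n} \<Longrightarrow> i k = j k" for n
    using that by (intro prod.cong) auto
  then show "cyl_len i n = cyl_len j n" using assms .
  show "cyl_left q i n = cyl_left q j n"
    using assms
  proof (induction n)
    case (Suc n)
    then show ?case using len[of n] by simp
  qed simp
qed

lemma cyl_nested:
  assumes "m \<le> n" "word n i"
  shows "cyl_left q i m \<le> cyl_left q i n"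
    and "cyl_left q i n + cyl_len i n \<le> cyl_left q i m + cyl_len i m"
proof -
  have "cyl_left q i m \<le> cyl_left q i n \<and>
      cyl_left q i n + cyl_len i n \<le> cyl_left q i m + cyl_len i m"
    using assms
  proof (induction n rule: dec_induct)
    case (step n)
    have d: "i (Suc n) \<in> digits N (Suc n)" "word n i"
      using step by auto
    note S = q_partial_sums[OF _ d(1)]
    have len: "0 \<le> cyl_len i n"
      using cyl_len_pos[OF d(2)] by simp
    have "cyl_left q i n \<le> cyl_left q i (Suc n)"
      using S len by simp
    moreover have "((\<Sum>j<i (Suc n). q j (Suc n)) + q (i (Suc n)) (Suc n)) * cyl_len i n
        \<le> 1 * cyl_len i n"
      using S len by (intro mult_right_mono) auto
    then have "cyl_left q i (Suc n) + cyl_len i (Suc n) \<le> cyl_left q i n + cyl_len i n"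
      by (simp add: algebra_simps)
    ultimately show ?case using step d by auto
  qed simp
  then show "cyl_left q i m \<le> cyl_left q i n"
    and "cyl_left q i n + cyl_len i n \<le> cyl_left q i m + cyl_len i m" by auto
qed

lemma cylinder_cong:
  assumes "\<And>k. k \<in> {1..n} \<Longrightarrow> i k = j k"
  shows "cylinder q i n = cylinder q j n"
  unfolding cylinder_def using cyl_cong[of n i j] assms by simp

text \<open>
  At the first difference, the two words choose subintervals of the same parent without common
  interior points, in the order of the digits; the later digits stay inside these.
\<close>

lemma cyl_ordered:
  assumes w: "word n i" "word n j" and K: "1 \<le> K" "K \<le> n"
    and eq: "\<And>k. k \<in> {1..<K} \<Longrightarrow> i k = j k" and less: "i K < j K"
  shows "cyl_left q i n + cyl_len i n \<le> cyl_left q j n"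
proof -
  obtain L where L: "K = Suc L" using K by (cases K) auto
  have cong: "cyl_left q i L = cyl_left q j L" "cyl_len i L = cyl_len j L"
    using eq L by (auto intro!: cyl_cong)
  have len: "0 \<le> cyl_len j L"
    using cyl_len_pos[of L j] w K L by simp
  have d: "x \<in> digits N K" if "x \<le> j K" for x
    using digits_downward[of "j K" K x] w K that by simp
  have "(\<Sum>x<i K. q x K) + q (i K) K = (\<Sum>x<Suc (i K). q x K)"
    by simp
  also have "\<dots> \<le> (\<Sum>x<j K. q x K)"
    using less d q_pos K by (intro sum_mono2) (auto simp: less_imp_le)
  finally have *: "((\<Sum>x<i K. q x K) + q (i K) K) * cyl_len j L \<le> (\<Sum>x<j K. q x K) * cyl_len j L"
    using len by (rule mult_right_mono)
  have "cyl_left q i n + cyl_len i n \<le> cyl_left q i K + cyl_len i K"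
    using w K by (intro cyl_nested) auto
  also have "\<dots> = cyl_left q j L + ((\<Sum>x<i K. q x K) + q (i K) K) * cyl_len j L"
    using cong by (simp add: L algebra_simps)
  also have "\<dots> \<le> cyl_left q j K"
    using * by (simp add: L)
  also have "\<dots> \<le> cyl_left q j n"
    using w K by (intro cyl_nested) auto
  finally show ?thesis .
qed

lemma cyl_separated:
  assumes w: "word n i" "word n j" and ne: "\<exists>k\<in>{1..n}. i k \<noteq> j k"
  shows "cyl_left q i n + cyl_len i n \<le> cyl_left q j n \<or>
    cyl_left q j n + cyl_len j n \<le> cyl_left q i n"
proof -
  define K where "K = (LEAST k. k \<in> {1..n} \<and> i k \<noteq> j k)"
  have K: "K \<in> {1..n} \<and> i K \<noteq> j K"
    unfolding K_def by (rule LeastI_ex[of "\<lambda>k. k \<in> {1..n} \<and> i k \<noteq> j k"]) (use ne in blast)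
  have eq: "i k = j k" if "k \<in> {1..<K}" for k
    using not_less_Least[of k "\<lambda>k. k \<in> {1..n} \<and> i k \<noteq> j k"] that K
    unfolding K_def[symmetric] by auto
  have "1 \<le> K" "K \<le> n" and "i K < j K \<or> j K < i K"
    using K by auto
  then show ?thesis
    using cyl_ordered[OF w _ _ eq] cyl_ordered[OF w(2,1) _ _ eq[symmetric]] by blast
qed

lemma cyl_half_open_disjoint:
  assumes "D \<subseteq> PiE {1..n} (digits N)"
  shows "disjoint_family_on (\<lambda>v. {cyl_left q v n..<cyl_left q v n + cyl_len v n}) D"
proof (unfold disjoint_family_on_def, intro ballI impI)
  fix v u assume vu: "v \<in> D" "u \<in> D" "v \<noteq> u"
  then have "word n v" "word n u"
    using assms by (auto simp: PiE_def Pi_def)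
  moreover have "\<exists>k\<in>{1..n}. v k \<noteq> u k"
  proof (rule ccontr)
    assume "\<not> ?thesis"
    then have "v = u"
      using vu assms by (intro PiE_ext[of v "{1..n}" "digits N" u]) auto
    then show False using vu by simp
  qed
  ultimately show "{cyl_left q v n..<cyl_left q v n + cyl_len v n} \<inter>
      {cyl_left q u n..<cyl_left q u n + cyl_len u n} = {}"
    using cyl_separated[of n v u] by auto
qed

lemma countable_words: "countable (PiE {1..n} (digits N))"
  by (intro countable_PiE) auto

lemma cyl_len_sum: "((\<lambda>v. cyl_len v n) has_sum 1) (PiE {1..n} (digits N))"
  using has_sum_prod_PiE_nonneg[of "{1..n}" "digits N" "\<lambda>k i. q i k" "\<lambda>_. 1"]
  by (simp add: q_sum q_pos[THEN less_imp_le])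

lemma cyl_len_summable: "D \<subseteq> PiE {1..n} (digits N) \<Longrightarrow> (\<lambda>v. cyl_len v n) summable_on D"
  using cyl_len_sum[THEN has_sum_imp_summable] by (rule summable_on_subset_banach)

lemma emeasure_half_open_cyls:
  assumes D: "D \<subseteq> PiE {1..n} (digits N)"
  shows "emeasure lborel (\<Union>v\<in>D. {cyl_left q v n..<cyl_left q v n + cyl_len v n}) =
    ennreal (\<Sum>\<^sub>\<infinity>v\<in>D. cyl_len v n)"
proof -
  have len: "0 < cyl_len v n" if "v \<in> D" for v
    using that D by (intro cyl_len_pos) (auto simp: PiE_def Pi_def)
  have "emeasure lborel (\<Union>v\<in>D. {cyl_left q v n..<cyl_left q v n + cyl_len v n}) =
      (\<integral>\<^sup>+v. emeasure lborel {cyl_left q v n..<cyl_left q v n + cyl_len v n} \<partial>count_space D)"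
    using D by (intro emeasure_UN_countable cyl_half_open_disjoint countable_subset[OF D countable_words]) auto
  also have "\<dots> = (\<integral>\<^sup>+v. ennreal (cyl_len v n) \<partial>count_space D)"
    using len by (intro nn_integral_cong) (auto simp: less_imp_le)
  also have "\<dots> = ennreal (\<Sum>\<^sub>\<infinity>v\<in>D. cyl_len v n)"
    using len cyl_len_summable[OF D] by (intro nn_integral_count_space_infsum) (auto simp: less_imp_le)
  finally show ?thesis .
qed

lemma cylinder_union_sets:
  assumes "D \<subseteq> PiE {1..n} (digits N)"
  shows "(\<Union>v\<in>D. cylinder q v n) \<in> sets borel"
  by (rule sets.countable_UN''[OF countable_subset[OF assms countable_words]])
     (simp add: cylinder_def)

text \<open>Right endpoints are countably many, hence do not contribute to the length.\<close>

lemma emeasure_cylinder_union: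
  assumes D: "D \<subseteq> PiE {1..n} (digits N)"
  shows "emeasure lborel (\<Union>v\<in>D. cylinder q v n) \<le> ennreal (\<Sum>\<^sub>\<infinity>v\<in>D. cyl_len v n)"
proof -
  let ?H = "\<Union>v\<in>D. {cyl_left q v n..<cyl_left q v n + cyl_len v n}"
  let ?E = "(\<lambda>v. cyl_left q v n + cyl_len v n) ` D"
  have cD: "countable D" using countable_subset[OF D countable_words] .
  then have H: "?H \<in> sets lborel"
    by (rule sets.countable_UN'') simp
  have E: "?E \<in> null_sets lborel"
    using cD by (intro countable_imp_null_set_lborel) auto
  have "emeasure lborel (\<Union>v\<in>D. cylinder q v n) \<le> emeasure lborel (?H \<union> ?E)"
  proof (rule emeasure_mono)
    show "(\<Union>v\<in>D. cylinder q v n) \<subseteq> ?H \<union> ?E"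
      by (fastforce simp: cylinder_def)
    show "?H \<union> ?E \<in> sets lborel"
      using H E by blast
  qed
  also have "\<dots> = emeasure lborel ?H"
    using H E by (rule emeasure_Un_null_set)
  finally show ?thesis
    using emeasure_half_open_cyls[OF D] by simp
qed

lemma cyl_len_sum_le_emeasure:
  assumes D: "D \<subseteq> PiE {1..n} (digits N)" and U: "U \<in> sets borel"
    and sub: "\<And>v. v \<in> D \<Longrightarrow> cylinder q v n \<subseteq> U"
  shows "ennreal (\<Sum>\<^sub>\<infinity>v\<in>D. cyl_len v n) \<le> emeasure lborel U"
proof -
  have "(\<Union>v\<in>D. {cyl_left q v n..<cyl_left q v n + cyl_len v n}) \<subseteq> U"
    using sub by (fastforce simp: cylinder_def)
  then show ?thesis
    using U unfolding emeasure_half_open_cyls[OF D, symmetric] by (intro emeasure_mono) auto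
qed

lemma cyl_len_bound:
  assumes "word n i"
  shows "cyl_len i n \<le> (\<Prod>k=1..n. col_max (digits N k) (\<lambda>i. q i k))"
proof (intro prod_mono conjI)
  fix k assume k: "k \<in> {1..n}"
  then show "0 \<le> q (i k) k" using q_pos assms by (auto simp: less_imp_le)
  have "\<And>i. i \<in> digits N k \<Longrightarrow> 0 \<le> q i k" "((\<lambda>i. q i k) has_sum 1) (digits N k)"
    using k q_pos q_sum by (auto simp: less_imp_le)
  then obtain a where "\<And>j. j \<in> digits N k \<Longrightarrow> q j k \<le> col_max (digits N k) (\<lambda>i. q i k)"
    using col_max_attained[of "digits N k" "\<lambda>i. q i k"] by blast
  then show "q (i k) k \<le> col_max (digits N k) (\<lambda>i. q i k)"
    using k assms by auto
qed

text \<open>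
  Every digit has at most the greatest length ratio of its column, and the product of
  these greatest ratios vanishes.
\<close>

lemma cyl_len_tendsto_0:
  assumes i: "\<And>k. 1 \<le> k \<Longrightarrow> i k \<in> digits N k"
  shows "(\<lambda>n. cyl_len i n) \<longlonglongrightarrow> 0"
proof (rule tendsto_sandwich)
  have col_max_01: "0 \<le> col_max (digits N k) (\<lambda>i. q i k) \<and> col_max (digits N k) (\<lambda>i. q i k) \<le> 1"
    if k: "1 \<le> k" for k
  proof -
    have *: "\<And>i. i \<in> digits N k \<Longrightarrow> 0 \<le> q i k" "((\<lambda>i. q i k) has_sum 1) (digits N k)"
      using k q_pos q_sum by (auto simp: less_imp_le)
    then obtain a where "a \<in> digits N k" "q a k = col_max (digits N k) (\<lambda>i. q i k)"
      using col_max_attained[of "digits N k" "\<lambda>i. q i k"] by blast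
    then show ?thesis
      using has_sum_one_le_one[OF *, of a] *(1)[of a] by simp
  qed
  show "\<forall>\<^sub>F n in sequentially. 0 \<le> cyl_len i n"
    using i by (intro always_eventually allI less_imp_le cyl_len_pos) auto
  show "\<forall>\<^sub>F n in sequentially. cyl_len i n \<le> (\<Prod>k=1..n. col_max (digits N k) (\<lambda>i. q i k))"
    using i by (intro always_eventually allI cyl_len_bound) auto
  show "(\<lambda>n. \<Prod>k=1..n. col_max (digits N k) (\<lambda>i. q i k)) \<longlonglongrightarrow> 0"
    using inf_product_lim(1)[of "\<lambda>k. col_max (digits N k) (\<lambda>i. q i k)", OF col_max_01] Q
    unfolding Q_matrix_def by simp
qed simp

lemma Delta_cylinders:
  assumes i: "\<And>k. 1 \<le> k \<Longrightarrow> i k \<in> digits N k"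
  shows "(\<lambda>n. cyl_left q i n) \<longlonglongrightarrow> Delta q i" and "Delta q i \<in> cylinder q i n"
proof -
  have w: "word n i" for n using i by simp
  have inc: "incseq (cyl_left q i)"
    by (intro incseq_SucI cyl_nested(1)[OF _ w]) simp
  have "cyl_left q i n \<le> 1" for n
    using cyl_nested(2)[OF _ w, of 0 n] cyl_len_pos[OF w, of n] by simp
  then obtain x where x: "cyl_left q i \<longlonglongrightarrow> x" "\<And>n. cyl_left q i n \<le> x"
    using incseq_convergent[OF inc, of 1] by blast
  have "x \<le> cyl_left q i n + cyl_len i n" for n
  proof (rule LIMSEQ_le_const2[OF x(1)])
    have "cyl_left q i m \<le> cyl_left q i n + cyl_len i n" if "n \<le> m" for m
      using cyl_nested(2)[OF that w] cyl_len_pos[OF w, of m] by simp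
    then show "\<exists>N. \<forall>m\<ge>N. cyl_left q i m \<le> cyl_left q i n + cyl_len i n" by blast
  qed
  then have x_in: "x \<in> cylinder q i n" for n
    using x(2) by (simp add: cylinder_def)
  have "Delta q i = x"
    unfolding Delta_def
  proof (rule the_equality)
    show "x \<in> (\<Inter>k\<in>{1..}. cylinder q i k)" using x_in by blast
    fix y assume y: "y \<in> (\<Inter>k\<in>{1..}. cylinder q i k)"
    have "\<bar>y - x\<bar> \<le> cyl_len i n" if "1 \<le> n" for n
      using y that x_in[of n] by (force simp: cylinder_def)
    then have "\<bar>y - x\<bar> \<le> 0"
      by (intro LIMSEQ_le_const[OF cyl_len_tendsto_0[OF i]]) blast+
    then show "y = x" by simp
  qed
  then show "(\<lambda>n. cyl_left q i n) \<longlonglongrightarrow> Delta q i" "Delta q i \<in> cylinder q i n"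
    using x x_in by auto
qed

end

section \<open>Random digits\<close>

locale random_digits = Q_digits N q + prob_space M
  for N :: "nat \<Rightarrow> enat" and q :: "nat \<Rightarrow> nat \<Rightarrow> real" and M :: "'a measure" +
  fixes p :: "nat \<Rightarrow> nat \<Rightarrow> real" and \<xi> :: "nat \<Rightarrow> 'a \<Rightarrow> nat"
  assumes p_nonneg: "\<And>k i. 1 \<le> k \<Longrightarrow> i \<in> digits N k \<Longrightarrow> 0 \<le> p i k"
    and p_sum: "\<And>k. 1 \<le> k \<Longrightarrow> ((\<lambda>i. p i k) has_sum 1) (digits N k)"
    and indep: "indep_vars (\<lambda>k. count_space (digits N k)) \<xi> {1..}"
    and distr: "\<And>k i. 1 \<le> k \<Longrightarrow> i \<in> digits N k \<Longrightarrow> prob {\<omega> \<in> space M. \<xi> k \<omega> = i} = p i k"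
begin

definition agree :: "nat set \<Rightarrow> (nat \<Rightarrow> nat) \<Rightarrow> 'a set" where
  "agree I v = {\<omega> \<in> space M. \<forall>k\<in>I. \<xi> k \<omega> = v k}"

definition word_event :: "nat set \<Rightarrow> (nat \<Rightarrow> nat) set \<Rightarrow> 'a set" where
  "word_event I D = {\<omega> \<in> space M. restrict (\<lambda>k. \<xi> k \<omega>) I \<in> D}"

abbreviation val :: "'a \<Rightarrow> real" where
  "val \<omega> \<equiv> Delta q (\<lambda>k. \<xi> k \<omega>)"

lemma measurable_digit: "1 \<le> k \<Longrightarrow> \<xi> k \<in> measurable M (count_space (digits N k))"
  using indep by (auto simp: indep_vars_def)

lemma digit_in: "1 \<le> k \<Longrightarrow> \<omega> \<in> space M \<Longrightarrow> \<xi> k \<omega> \<in> digits N k"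
  using measurable_space[OF measurable_digit] by simp

lemma digit_borel: "1 \<le> k \<Longrightarrow> (\<lambda>\<omega>. f (\<xi> k \<omega>) :: real) \<in> borel_measurable M"
  by (rule measurable_compose[OF measurable_digit]) (simp_all add: measurable_count_space_eq1)

lemma agree_event:
  assumes "I \<subseteq> {1..}"
  shows "agree I v \<in> events"
proof -
  have "{\<omega> \<in> space M. \<xi> k \<omega> = v k} \<in> events" if "k \<in> I" for k
  proof -
    have "1 \<le> k" using that assms by auto
    then have "\<xi> k -` ({v k} \<inter> digits N k) \<inter> space M \<in> events"
      by (intro measurable_sets[OF measurable_digit]) auto
    moreover have "\<xi> k -` ({v k} \<inter> digits N k) \<inter> space M = {\<omega> \<in> space M. \<xi> k \<omega> = v k}"
      using digit_in[OF \<open>1 \<le> k\<close>] by auto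
    ultimately show ?thesis by simp
  qed
  then show ?thesis
    unfolding agree_def by (intro sets.sets_Collect_countable_All') auto
qed

lemma prob_agree:
  assumes I: "finite I" "I \<subseteq> {1..}" and v: "\<And>k. k \<in> I \<Longrightarrow> v k \<in> digits N k"
  shows "prob (agree I v) = (\<Prod>k\<in>I. p (v k) k)"
proof (cases "I = {}")
  case True
  then show ?thesis by (simp add: agree_def prob_space)
next
  case False
  have "agree I v = (\<Inter>k\<in>I. \<xi> k -` {v k} \<inter> space M)"
    using False by (auto simp: agree_def)
  also have "prob \<dots> = (\<Prod>k\<in>I. prob (\<xi> k -` {v k} \<inter> space M))"
    using indep False I v by (intro indep_varsD[where I="{1..}"]) auto
  also have "\<dots> = (\<Prod>k\<in>I. p (v k) k)"
  proof (intro prod.cong refl)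
    fix k assume k: "k \<in> I"
    have "\<xi> k -` {v k} \<inter> space M = {\<omega> \<in> space M. \<xi> k \<omega> = v k}" by auto
    then show "prob (\<xi> k -` {v k} \<inter> space M) = p (v k) k"
      using distr[of k "v k"] k I v by auto
  qed
  finally show ?thesis .
qed

lemma countable_PiE_digits: "finite I \<Longrightarrow> D \<subseteq> PiE I (digits N) \<Longrightarrow> countable D"
  by (rule countable_subset[of D "PiE I (digits N)"]) (auto intro: countable_PiE)

lemma word_event_UN:
  assumes D: "D \<subseteq> PiE I (digits N)"
  shows "word_event I D = (\<Union>v\<in>D. agree I v)"
proof (intro set_eqI iffI)
  fix \<omega> assume "\<omega> \<in> word_event I D"
  then show "\<omega> \<in> (\<Union>v\<in>D. agree I v)"
    by (auto simp: word_event_def agree_def intro!: bexI[of _ "restrict (\<lambda>k. \<xi> k \<omega>) I"])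
next
  fix \<omega> assume "\<omega> \<in> (\<Union>v\<in>D. agree I v)"
  then obtain v where v: "v \<in> D" "\<omega> \<in> agree I v" by blast
  then have "restrict (\<lambda>k. \<xi> k \<omega>) I = v"
    using D by (intro ext) (auto simp: agree_def restrict_def PiE_def extensional_def)
  then show "\<omega> \<in> word_event I D"
    using v by (auto simp: word_event_def agree_def)
qed

lemma word_event_event:
  assumes "finite I" "I \<subseteq> {1..}" "D \<subseteq> PiE I (digits N)"
  shows "word_event I D \<in> events"
  unfolding word_event_UN[OF assms(3)]
  using countable_PiE_digits[OF assms(1,3)] agree_event[OF assms(2)]
  by (rule sets.countable_UN'')

lemma word_event_all: "I \<subseteq> {1..} \<Longrightarrow> word_event I (PiE I (digits N)) = space M"
  using digit_in by (auto simp: word_event_def)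

lemma prob_split_words:
  assumes I: "finite I" "I \<subseteq> {1..}" and D: "D \<subseteq> PiE I (digits N)" and E: "E \<in> events"
  shows "((\<lambda>v. prob (E \<inter> agree I v)) has_sum prob (E \<inter> word_event I D)) D"
proof -
  have "((\<lambda>v. prob (E \<inter> agree I v)) has_sum prob (\<Union>v\<in>D. E \<inter> agree I v)) D"
  proof (rule has_sum_measure_disjoint_UN)
    show "E \<inter> agree I v \<in> events" for v
      using E agree_event[OF I(2)] by blast
    show "countable D" using countable_PiE_digits I D by blast
    show "disjoint_family_on (\<lambda>v. E \<inter> agree I v) D"
      unfolding disjoint_family_on_def
    proof (intro ballI impI)
      fix v u assume vu: "v \<in> D" "u \<in> D" "v \<noteq> u"
      show "(E \<inter> agree I v) \<inter> (E \<inter> agree I u) = {}"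
      proof (rule ccontr)
        assume "\<not> ?thesis"
        then have "v k = u k" if "k \<in> I" for k
          using that by (auto simp: agree_def)
        then have "v = u"
          using vu D by (intro PiE_ext[of v I "digits N" u]) auto
        then show False using vu by simp
      qed
    qed
  qed
  moreover have "(\<Union>v\<in>D. E \<inter> agree I v) = E \<inter> word_event I D"
    unfolding word_event_UN[OF D] by blast
  ultimately show ?thesis by simp
qed

lemma prob_word_event:
  assumes I: "finite I" "I \<subseteq> {1..}" and D: "D \<subseteq> PiE I (digits N)"
  shows "((\<lambda>v. \<Prod>k\<in>I. p (v k) k) has_sum prob (word_event I D)) D"
proof -
  have sub: "A \<subseteq> space M" if "A \<in> events" for A
    using that by (rule sets.sets_into_space)
  have eq: "prob (space M \<inter> agree I v) = (\<Prod>k\<in>I. p (v k) k)" if "v \<in> D" for v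
    using prob_agree[OF I, of v] that D sub[OF agree_event[OF I(2), of v]]
    by (auto simp: Int_absorb1)
  show ?thesis
    using prob_split_words[OF I D sets.top] eq sub[OF word_event_event[OF I D]]
    by (subst has_sum_cong[of D _ "\<lambda>v. prob (space M \<inter> agree I v)"]) (auto simp: Int_absorb1)
qed

lemma measurable_cyl_len: "(\<lambda>\<omega>. cyl_len (\<lambda>k. \<xi> k \<omega>) n) \<in> borel_measurable M"
  by (intro borel_measurable_prod digit_borel) auto

lemma measurable_cyl_left: "(\<lambda>\<omega>. cyl_left q (\<lambda>k. \<xi> k \<omega>) n) \<in> borel_measurable M"
proof (induction n)
  case (Suc n)
  have "(\<lambda>\<omega>. \<Sum>j<\<xi> (Suc n) \<omega>. q j (Suc n)) \<in> borel_measurable M"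
    using digit_borel[of "Suc n" "\<lambda>i. \<Sum>j<i. q j (Suc n)"] by simp
  then show ?case
    using Suc measurable_cyl_len[of n]
    by (simp only: cyl_left.simps) (intro borel_measurable_add borel_measurable_times)
qed simp

lemma measurable_val: "val \<in> borel_measurable M"
proof (rule borel_measurable_LIMSEQ_real)
  show "(\<lambda>n. cyl_left q (\<lambda>k. \<xi> k \<omega>) n) \<longlonglongrightarrow> val \<omega>" if "\<omega> \<in> space M" for \<omega>
    using digit_in that by (intro Delta_cylinders) auto
qed (rule measurable_cyl_left)

lemma val_in_cylinder: "\<omega> \<in> space M \<Longrightarrow> val \<omega> \<in> cylinder q (\<lambda>k. \<xi> k \<omega>) n"
  using digit_in by (intro Delta_cylinders) auto

subsection \<open>Atoms\<close>

abbreviation p_max :: "nat \<Rightarrow> real" where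
  "p_max k \<equiv> col_max (digits N k) (\<lambda>i. p i k)"

lemma p_max:
  assumes "1 \<le> k"
  obtains i where "i \<in> digits N k" "p i k = p_max k"
    and "\<And>j. j \<in> digits N k \<Longrightarrow> p j k \<le> p_max k"
  using col_max_attained[of "digits N k" "\<lambda>i. p i k"] p_nonneg p_sum assms by blast

lemma p_max_01: "1 \<le> k \<Longrightarrow> 0 \<le> p_max k \<and> p_max k \<le> 1"
  using p_max[of k] p_nonneg[of k] has_sum_one_le_one[of "digits N k" "\<lambda>i. p i k"] p_sum[of k]
  by metis

lemma prob_le_if_digits_constant:
  assumes E: "E \<subseteq> space M"
    and const: "\<And>\<omega> \<omega>' k. \<omega> \<in> E \<Longrightarrow> \<omega>' \<in> E \<Longrightarrow> k \<in> {1..n} \<Longrightarrow> \<xi> k \<omega> = \<xi> k \<omega>'"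
  shows "prob E \<le> (\<Prod>k=1..n. p_max k)"
proof (cases "E = {}")
  case True
  then show ?thesis using p_max_01 by (auto intro!: prod_nonneg)
next
  case False
  then obtain \<omega> where \<omega>: "\<omega> \<in> E" "\<omega> \<in> space M" using E by blast
  have d: "\<xi> k \<omega> \<in> digits N k" if "k \<in> {1..n}" for k
    using digit_in that \<omega> by auto
  have "E \<subseteq> agree {1..n} (\<lambda>k. \<xi> k \<omega>)"
    using E const[OF _ \<omega>(1)] by (auto simp: agree_def)
  then have "prob E \<le> prob (agree {1..n} (\<lambda>k. \<xi> k \<omega>))"
    by (intro finite_measure_mono agree_event) auto
  also have "\<dots> = (\<Prod>k=1..n. p (\<xi> k \<omega>) k)"
    using d by (intro prob_agree) auto
  also have "\<dots> \<le> (\<Prod>k=1..n. p_max k)"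
  proof (intro prod_mono conjI)
    fix k assume k: "k \<in> {1..n}"
    then show "0 \<le> p (\<xi> k \<omega>) k" using d p_nonneg by simp
    show "p (\<xi> k \<omega>) k \<le> p_max k"
      using k d[OF k] p_max[of k] by (metis atLeastAtMost_iff)
  qed
  finally show ?thesis .
qed

text \<open>
  A point lies in at most one interval of rank \<open>n\<close> that is closed on the left and open on the
  right, and in at most one that is open on the left and closed on the right. Hence its mass is
  at most twice the largest mass of a cylinder.
\<close>

lemma prob_point_le:
  "prob {\<omega> \<in> space M. val \<omega> = x} \<le> 2 * (\<Prod>k=1..n. p_max k)"
proof -
  let ?l = "\<lambda>\<omega>. cyl_left q (\<lambda>k. \<xi> k \<omega>) n" and ?L = "\<lambda>\<omega>. cyl_len (\<lambda>k. \<xi> k \<omega>) n"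
  define A where "A = {\<omega> \<in> space M. val \<omega> = x \<and> x < ?l \<omega> + ?L \<omega>}"
  define B where "B = {\<omega> \<in> space M. val \<omega> = x \<and> ?l \<omega> < x}"
  have w: "word n (\<lambda>k. \<xi> k \<omega>)" if "\<omega> \<in> space M" for \<omega>
    using digit_in that by auto
  have cyl: "?l \<omega> \<le> x \<and> x \<le> ?l \<omega> + ?L \<omega>" if "\<omega> \<in> space M" "val \<omega> = x" for \<omega>
    using val_in_cylinder[OF that(1), of n] that(2) by (simp add: cylinder_def)
  have sep: "(\<forall>k\<in>{1..n}. \<xi> k \<omega> = \<xi> k \<omega>') \<or>
      ?l \<omega> + ?L \<omega> \<le> ?l \<omega>' \<or> ?l \<omega>' + ?L \<omega>' \<le> ?l \<omega>"
    if "\<omega> \<in> space M" "\<omega>' \<in> space M" for \<omega> \<omega>'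
    using cyl_separated[OF w[OF that(1)] w[OF that(2)]] by blast
  have [measurable]: "?l \<in> borel_measurable M" "?L \<in> borel_measurable M" "val \<in> borel_measurable M"
    using measurable_cyl_left measurable_cyl_len measurable_val by auto
  have "prob A \<le> (\<Prod>k=1..n. p_max k)"
  proof (rule prob_le_if_digits_constant)
    fix \<omega> \<omega>' k assume "\<omega> \<in> A" "\<omega>' \<in> A" "k \<in> {1..n}"
    then show "\<xi> k \<omega> = \<xi> k \<omega>'"
      using sep[of \<omega> \<omega>'] cyl[of \<omega>] cyl[of \<omega>'] by (auto simp: A_def)
  qed (auto simp: A_def)
  moreover have "prob B \<le> (\<Prod>k=1..n. p_max k)"
  proof (rule prob_le_if_digits_constant)
    fix \<omega> \<omega>' k assume "\<omega> \<in> B" "\<omega>' \<in> B" "k \<in> {1..n}"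
    then show "\<xi> k \<omega> = \<xi> k \<omega>'"
      using sep[of \<omega> \<omega>'] cyl[of \<omega>] cyl[of \<omega>'] by (auto simp: B_def)
  qed (auto simp: B_def)
  moreover have "A \<in> events" "B \<in> events"
    unfolding A_def B_def by measurable
  moreover have "{\<omega> \<in> space M. val \<omega> = x} \<subseteq> A \<union> B"
  proof
    fix \<omega> assume \<omega>: "\<omega> \<in> {\<omega> \<in> space M. val \<omega> = x}"
    then have "0 < ?L \<omega>" using cyl_len_pos[OF w] by simp
    then show "\<omega> \<in> A \<union> B" using \<omega> cyl[of \<omega>] by (auto simp: A_def B_def)
  qed
  ultimately show ?thesis
    using finite_measure_mono[of "{\<omega> \<in> space M. val \<omega> = x}" "A \<union> B"] measure_Un_le[of A M B]
    by simp
qed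

lemma atomless:
  assumes "inf_product p_max = 0"
  shows "prob {\<omega> \<in> space M. val \<omega> = x} = 0"
proof -
  have "(\<lambda>n. 2 * (\<Prod>k=1..n. p_max k)) \<longlonglongrightarrow> 2 * inf_product p_max"
    using p_max_01 by (intro tendsto_intros inf_product_lim) auto
  then have "prob {\<omega> \<in> space M. val \<omega> = x} \<le> 2 * inf_product p_max"
    by (rule LIMSEQ_le_const) (use prob_point_le in blast)
  then show ?thesis
    using assms by (simp add: measure_le_0_iff)
qed

text \<open>
  If the product of the largest digit probabilities is positive, then almost surely all but
  finitely many digits are most probable ones, and there are only countably many such sequences.
\<close>

lemma countably_many_values:
  assumes pos: "0 < inf_product p_max"
  shows "\<exists>C. countable C \<and> prob {\<omega> \<in> space M. val \<omega> \<in> C} = 1"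
proof -
  have "\<exists>i. i \<in> digits N k \<and> p i k = p_max k" if "1 \<le> k" for k
    using p_max[OF that] by metis
  then obtain a where a: "\<And>k. 1 \<le> k \<Longrightarrow> a k \<in> digits N k" "\<And>k. 1 \<le> k \<Longrightarrow> p (a k) k = p_max k"
    by metis
  define S where "S m = {i. \<forall>k>m. i k = a k}" for m :: nat
  \<comment> \<open>An element of \<open>S m\<close> is determined by the list of its first values.\<close>
  have "S m \<subseteq> range (\<lambda>xs::nat list. \<lambda>k. if k \<le> m then xs ! k else a k)" for m
  proof
    fix i assume "i \<in> S m"
    then have "i = (\<lambda>k. if k \<le> m then map i [0..<Suc m] ! k else a k)"
      by (auto simp: S_def nth_append simp del: upt_Suc)
    then show "i \<in> range (\<lambda>xs::nat list. \<lambda>k. if k \<le> m then xs ! k else a k)" by (rule range_eqI)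
  qed
  then have "countable (S m)" for m
    by (rule countable_subset) simp
  then have cC: "countable (Delta q ` (\<Union>m. S m))" by blast
  define C where "C = Delta q ` (\<Union>m. S m)"
  have [measurable]: "C \<in> sets borel"
    unfolding C_def using cC by (rule sets.countable[rotated]) auto
  have [measurable]: "val \<in> borel_measurable M" by (rule measurable_val)
  have "inf_product p_max / (\<Prod>k=1..m. p_max k) \<le> prob {\<omega> \<in> space M. val \<omega> \<in> C}" for m
  proof -
    \<comment> \<open>The events \<open>G n\<close> decrease to the event that all digits after the \<open>m\<close>-th one are most probable.\<close>
    define G where "G n = agree {m<..m + n} a" for n
    have "prob (G n) = (\<Prod>k\<in>{m<..m + n}. p_max k)" for n
    proof -
      have "prob (G n) = (\<Prod>k\<in>{m<..m + n}. p (a k) k)"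
        unfolding G_def using a by (intro prob_agree) auto
      also have "\<dots> = (\<Prod>k\<in>{m<..m + n}. p_max k)"
        using a by (intro prod.cong) auto
      finally show ?thesis .
    qed
    then have "inf_product p_max / (\<Prod>k=1..m. p_max k) \<le> prob (G n)" for n
      using inf_product_tail(3)[OF p_max_01 pos, of m "m + n"] by simp
    moreover have "(\<lambda>n. prob (G n)) \<longlonglongrightarrow> prob (\<Inter>n. G n)"
    proof (rule finite_Lim_measure_decseq)
      show "range G \<subseteq> events"
        unfolding G_def by (auto intro!: agree_event)
      show "decseq G"
        unfolding G_def agree_def by (intro decseq_SucI) auto
    qed
    ultimately have "inf_product p_max / (\<Prod>k=1..m. p_max k) \<le> prob (\<Inter>n. G n)"
      by (intro LIMSEQ_le_const) auto
    also have "\<dots> \<le> prob {\<omega> \<in> space M. val \<omega> \<in> C}"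
    proof (rule finite_measure_mono)
      show "(\<Inter>n. G n) \<subseteq> {\<omega> \<in> space M. val \<omega> \<in> C}"
      proof
        fix \<omega> assume \<omega>: "\<omega> \<in> (\<Inter>n. G n)"
        have "\<xi> k \<omega> = a k" if "m < k" for k
        proof -
          have "\<omega> \<in> G k" using \<omega> by blast
          then show ?thesis using that by (auto simp: G_def agree_def)
        qed
        then have "(\<lambda>k. \<xi> k \<omega>) \<in> S m" by (simp add: S_def)
        moreover have "\<omega> \<in> space M" using \<omega> by (auto simp: G_def agree_def)
        ultimately show "\<omega> \<in> {\<omega> \<in> space M. val \<omega> \<in> C}" unfolding C_def by blast
      qed
    qed measurable
    finally show ?thesis .
  qed
  then have "1 \<le> prob {\<omega> \<in> space M. val \<omega> \<in> C}"
    by (intro LIMSEQ_le_const2[OF inf_product_tail(1)[OF p_max_01 pos]]) auto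
  then have "prob {\<omega> \<in> space M. val \<omega> \<in> C} = 1"
    by (intro antisym) auto
  then show ?thesis using cC unfolding C_def by blast
qed

subsection \<open>Affinity of the digit distributions\<close>

text \<open>The Hellinger affinity (Bhattacharyya coefficient) of the two laws of the \<open>k\<close>-th digit.\<close>

definition affinity :: "nat \<Rightarrow> real" where
  "affinity k = (\<Sum>\<^sub>\<infinity>i\<in>digits N k. sqrt (p i k * q i k))"

lemma affinity_sum:
  assumes "1 \<le> k"
  shows "((\<lambda>i. sqrt (p i k * q i k)) has_sum affinity k) (digits N k)"
    and "0 \<le> affinity k \<and> affinity k \<le> 1"
proof -
  have p: "(\<lambda>i. p i k) summable_on digits N k" "infsum (\<lambda>i. p i k) (digits N k) = 1"
    and q: "(\<lambda>i. q i k) summable_on digits N k" "infsum (\<lambda>i. q i k) (digits N k) = 1"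
    using p_sum[OF assms] q_sum[OF assms] by (auto simp: has_sum_iff)
  note nn = p_nonneg[OF assms] q_pos[OF assms, THEN less_imp_le]
  show "((\<lambda>i. sqrt (p i k * q i k)) has_sum affinity k) (digits N k)"
    using infsum_Cauchy_Schwarz(1)[OF p(1) nn(1) q(1) nn(2)] by (simp add: affinity_def)
  have "affinity k \<le> 1"
    using infsum_Cauchy_Schwarz(2)[OF p(1) nn(1) q(1) nn(2)] by (simp add: affinity_def p q)
  moreover have "0 \<le> affinity k"
    unfolding affinity_def using nn by (intro infsum_nonneg) auto
  ultimately show "0 \<le> affinity k \<and> affinity k \<le> 1" by simp
qed

context
  fixes I :: "nat set"
  assumes I: "finite I" "I \<subseteq> {1..}"
begin

abbreviation P_word :: "(nat \<Rightarrow> nat) \<Rightarrow> real" where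
  "P_word v \<equiv> \<Prod>k\<in>I. p (v k) k"

abbreviation Q_word :: "(nat \<Rightarrow> nat) \<Rightarrow> real" where
  "Q_word v \<equiv> \<Prod>k\<in>I. q (v k) k"

lemma word_weights_nonneg:
  assumes "v \<in> PiE I (digits N)"
  shows "0 \<le> P_word v" "0 \<le> Q_word v"
proof -
  have "0 \<le> p (v k) k" "0 \<le> q (v k) k" if "k \<in> I" for k
    using that assms I(2) p_nonneg[of k "v k"] q_pos[of k "v k", THEN less_imp_le] by auto
  then show "0 \<le> P_word v" "0 \<le> Q_word v"
    by (simp_all add: prod_nonneg)
qed

text \<open>Affinity is multiplicative, because the square root of a product weight is a product weight.\<close>

lemma word_weight_sums:
  shows "(P_word has_sum 1) (PiE I (digits N))"
    and "(Q_word has_sum 1) (PiE I (digits N))"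
    and "((\<lambda>v. sqrt (P_word v * Q_word v)) has_sum (\<Prod>k\<in>I. affinity k)) (PiE I (digits N))"
proof -
  have I1: "1 \<le> k" if "k \<in> I" for k using I that by auto
  have "(P_word has_sum (\<Prod>k\<in>I. 1)) (PiE I (digits N))"
    by (intro has_sum_prod_PiE_nonneg I p_nonneg p_sum I1)
  then show "(P_word has_sum 1) (PiE I (digits N))" by simp
  have "(Q_word has_sum (\<Prod>k\<in>I. 1)) (PiE I (digits N))"
    by (intro has_sum_prod_PiE_nonneg I q_pos[THEN less_imp_le] q_sum I1)
  then show "(Q_word has_sum 1) (PiE I (digits N))" by simp
  have "((\<lambda>v. \<Prod>k\<in>I. sqrt (p (v k) k * q (v k) k)) has_sum (\<Prod>k\<in>I. affinity k)) (PiE I (digits N))"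
    by (intro has_sum_prod_PiE_nonneg I affinity_sum I1 real_sqrt_ge_zero mult_nonneg_nonneg
      p_nonneg q_pos[THEN less_imp_le])
  moreover have "(\<Prod>k\<in>I. sqrt (p (v k) k * q (v k) k)) = sqrt (P_word v * Q_word v)" for v
    using I(1) by induction (simp_all add: real_sqrt_mult ac_simps)
  ultimately show "((\<lambda>v. sqrt (P_word v * Q_word v)) has_sum (\<Prod>k\<in>I. affinity k)) (PiE I (digits N))"
    by simp
qed

lemma word_weights_summable:
  assumes "D \<subseteq> PiE I (digits N)"
  shows "P_word summable_on D" "Q_word summable_on D" "(\<lambda>v. sqrt (P_word v * Q_word v)) summable_on D"
  using assms word_weight_sums[THEN has_sum_imp_summable] by (auto intro: summable_on_subset_banach)

text \<open>
  Sorting words by which of the two weights is larger separates the two distributions up to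
  their affinity, since \<open>min a b \<le> sqrt (a * b)\<close>.
\<close>

lemma affinity_separates:
  defines "D \<equiv> {v \<in> PiE I (digits N). Q_word v \<le> P_word v}"
  shows "infsum Q_word D \<le> (\<Prod>k\<in>I. affinity k)"
    and "infsum P_word (PiE I (digits N) - D) \<le> (\<Prod>k\<in>I. affinity k)"
proof -
  let ?W = "PiE I (digits N)" and ?a = "\<lambda>v. sqrt (P_word v * Q_word v)"
  have D: "D \<subseteq> ?W" by (auto simp: D_def)
  have sub: "infsum ?a E \<le> (\<Prod>k\<in>I. affinity k)" if "E \<subseteq> ?W" for E
  proof -
    have "infsum ?a E \<le> infsum ?a ?W"
      using that word_weights_summable word_weights_nonneg
      by (intro infsum_mono2) auto
    then show ?thesis using word_weight_sums(3) by (simp add: infsumI)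
  qed
  have "infsum Q_word D \<le> infsum ?a D"
  proof (rule infsum_mono)
    fix v assume "v \<in> D"
    then have "Q_word v * Q_word v \<le> P_word v * Q_word v" "0 \<le> Q_word v"
      using word_weights_nonneg[of v] by (auto simp: D_def intro!: mult_right_mono)
    then show "Q_word v \<le> ?a v"
      by (intro real_le_rsqrt) (simp add: power2_eq_square)
  qed (use D word_weights_summable in auto)
  then show "infsum Q_word D \<le> (\<Prod>k\<in>I. affinity k)"
    using sub[OF D] by simp
  have "infsum P_word (?W - D) \<le> infsum ?a (?W - D)"
  proof (rule infsum_mono)
    fix v assume "v \<in> ?W - D"
    then have "P_word v * P_word v \<le> P_word v * Q_word v" "0 \<le> P_word v"
      using word_weights_nonneg[of v] by (auto simp: D_def intro!: mult_left_mono)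
    then show "P_word v \<le> ?a v"
      by (intro real_le_rsqrt) (simp add: power2_eq_square)
  qed (use word_weights_summable in auto)
  then show "infsum P_word (?W - D) \<le> (\<Prod>k\<in>I. affinity k)"
    using sub[of "?W - D"] by simp
qed

text \<open>
  Cauchy--Schwarz on a set of words and on its complement. In this form, high affinity forbids
  that words of small total weight for \<open>q\<close> carry almost all the weight for \<open>p\<close>.
\<close>

lemma affinity_le:
  assumes D: "D \<subseteq> PiE I (digits N)"
  shows "(\<Prod>k\<in>I. affinity k) \<le> sqrt (infsum Q_word D) + sqrt (1 - infsum P_word D)"
proof -
  let ?W = "PiE I (digits N)" and ?a = "\<lambda>v. sqrt (P_word v * Q_word v)"
  have split: "infsum f ?W = infsum f D + infsum f (?W - D)" if "f summable_on ?W" for f :: "_ \<Rightarrow> real"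
  proof -
    have "?W = D \<union> (?W - D)" using D by blast
    then show ?thesis
      using that summable_on_subset_banach[OF that] D
      by (metis Diff_disjoint Diff_subset infsum_Un_disjoint)
  qed
  note nn = word_weights_nonneg
  have P: "infsum P_word ?W = 1" and Q: "infsum Q_word ?W = 1"
    using word_weight_sums by (auto simp: infsumI)
  have P1: "infsum P_word D \<le> 1" and Q1: "infsum Q_word (?W - D) \<le> 1"
    using infsum_mono2[of P_word D ?W] infsum_mono2[of Q_word "?W - D" ?W] nn D P Q
      word_weights_summable by auto
  have "(\<Prod>k\<in>I. affinity k) = infsum ?a D + infsum ?a (?W - D)"
    using split[of ?a] word_weight_sums(3) by (simp add: has_sum_iff)
  also have "infsum ?a D \<le> sqrt (infsum P_word D) * sqrt (infsum Q_word D)"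
    using D nn by (intro infsum_Cauchy_Schwarz word_weights_summable) auto
  also have "\<dots> \<le> 1 * sqrt (infsum Q_word D)"
    using P1 D nn by (intro mult_right_mono) (auto intro!: infsum_nonneg)
  also have "infsum ?a (?W - D) \<le> sqrt (infsum P_word (?W - D)) * sqrt (infsum Q_word (?W - D))"
    using nn by (intro infsum_Cauchy_Schwarz word_weights_summable) auto
  also have "\<dots> \<le> sqrt (infsum P_word (?W - D)) * 1"
    using Q1 nn by (intro mult_left_mono) (auto intro!: infsum_nonneg)
  also have "infsum P_word (?W - D) = 1 - infsum P_word D"
    using split[of P_word] word_weights_summable P by simp
  finally show ?thesis by simp
qed

end

subsection \<open>Affinity zero\<close>

text \<open>
  The set consists of the cylinders of the words that are at least as heavy for \<open>p\<close> as for \<open>q\<close>, at a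
  rank where the affinity of the words is below \<open>e\<close>.
\<close>

lemma nearly_singular:
  fixes e :: real
  assumes zero: "inf_product affinity = 0" and e: "0 < e"
  shows "\<exists>A\<in>sets borel. emeasure lborel A \<le> ennreal e \<and> prob {\<omega> \<in> space M. val \<omega> \<notin> A} \<le> e"
proof -
  have "(\<lambda>n. \<Prod>k=1..n. affinity k) \<longlonglongrightarrow> 0"
    using inf_product_lim(1)[of affinity] affinity_sum(2) zero by simp
  then have "\<forall>\<^sub>F n in sequentially. (\<Prod>k=1..n. affinity k) < e"
    using e by (rule order_tendstoD)
  then obtain n where n: "(\<Prod>k=1..n. affinity k) < e"
    by (auto simp: eventually_sequentially)
  let ?I = "{1..n}"
  let ?W = "PiE ?I (digits N)"
  have I: "finite ?I" "?I \<subseteq> {1..}" by auto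
  define D where "D = {v \<in> ?W. cyl_len v n \<le> P_word ?I v}"
  define A where "A = (\<Union>v\<in>D. cylinder q v n)"
  have D: "D \<subseteq> ?W" by (auto simp: D_def)
  have A[measurable]: "A \<in> sets borel"
    unfolding A_def using D by (rule cylinder_union_sets)
  have "emeasure lborel A \<le> ennreal (\<Sum>\<^sub>\<infinity>v\<in>D. cyl_len v n)"
    unfolding A_def using D by (rule emeasure_cylinder_union)
  also have "\<dots> \<le> ennreal e"
    using affinity_separates(1)[OF I] n unfolding D_def by (intro ennreal_leI) simp
  finally have "emeasure lborel A \<le> ennreal e" .
  moreover have "prob {\<omega> \<in> space M. val \<omega> \<notin> A} \<le> e"
  proof -
    have "{\<omega> \<in> space M. val \<omega> \<notin> A} \<subseteq> word_event ?I (?W - D)"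
    proof
      fix \<omega> assume \<omega>: "\<omega> \<in> {\<omega> \<in> space M. val \<omega> \<notin> A}"
      let ?v = "restrict (\<lambda>k. \<xi> k \<omega>) ?I"
      have "cylinder q ?v n = cylinder q (\<lambda>k. \<xi> k \<omega>) n"
        by (rule cylinder_cong) simp
      then have "?v \<notin> D"
        using \<omega> val_in_cylinder[of \<omega> n] by (auto simp: A_def)
      moreover have "?v \<in> ?W" using \<omega> digit_in by auto
      ultimately show "\<omega> \<in> word_event ?I (?W - D)"
        using \<omega> by (simp add: word_event_def)
    qed
    then have "prob {\<omega> \<in> space M. val \<omega> \<notin> A} \<le> prob (word_event ?I (?W - D))"
      by (intro finite_measure_mono word_event_event) auto
    also have "\<dots> = infsum (P_word ?I) (?W - D)"
      using prob_word_event[OF I, of "?W - D"] by (auto simp: infsumI)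
    also have "\<dots> \<le> e"
      using affinity_separates(2)[OF I] n unfolding D_def by simp
    finally show ?thesis .
  qed
  ultimately show ?thesis using A by blast
qed

subsection \<open>Affinity positive\<close>

text \<open>
  Given the first \<open>m\<close> digits \<open>w\<close>, consider the later digits up to rank \<open>n\<close> whose cylinder lies in
  a set \<open>U\<close>. Relative to the cylinder of \<open>w\<close> their lengths sum to at most \<open>\<delta>\<close>, so that
  \<open>affinity_le\<close> keeps their conditional probability away from 1, by an amount that is the same
  for all ranks \<open>n\<close>.
\<close>

lemma prob_prefix_open_le:
  fixes w :: "nat \<Rightarrow> nat" and r \<delta> :: real
  assumes w: "word m w" and mn: "m \<le> n"
    and r: "r \<le> (\<Prod>k\<in>{m<..n}. affinity k)"
    and U: "U \<in> sets borel" "emeasure lborel U \<le> ennreal (\<delta> * cyl_len w m)"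
    and \<delta>: "0 < \<delta>" "sqrt \<delta> \<le> r"
  defines "C \<equiv> {u \<in> PiE {m<..n} (digits N). cylinder q (\<lambda>k. if k \<le> m then w k else u k) n \<subseteq> U}"
  shows "prob (agree {1..m} w \<inter> word_event {m<..n} C) \<le>
    prob (agree {1..m} w) * (1 - (r - sqrt \<delta>)\<^sup>2)"
proof -
  let ?I = "{m<..n}"
  let ?glue = "\<lambda>u k. if k \<le> m then w k else u k"
  let ?g = "\<lambda>u. restrict (?glue u) {1..n}"
  have I: "finite ?I" "?I \<subseteq> {1..}" by auto
  have split: "{1..n} = {1..m} \<union> ?I" using mn by auto
  have prod_glue: "(\<Prod>k=1..n. f (?glue u k) k) = (\<Prod>k=1..m. f (w k) k) * (\<Prod>k\<in>?I. f (u k) k)"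
    for f :: "nat \<Rightarrow> nat \<Rightarrow> real" and u
  proof -
    have "(\<Prod>k=1..n. f (?glue u k) k) = (\<Prod>k=1..m. f (?glue u k) k) * (\<Prod>k\<in>?I. f (?glue u k) k)"
      unfolding split by (intro prod.union_disjoint) auto
    also have "(\<Prod>k=1..m. f (?glue u k) k) = (\<Prod>k=1..m. f (w k) k)"
      by (intro prod.cong) auto
    also have "(\<Prod>k\<in>?I. f (?glue u k) k) = (\<Prod>k\<in>?I. f (u k) k)"
      by (intro prod.cong) auto
    finally show ?thesis .
  qed
  have C: "C \<subseteq> PiE ?I (digits N)" by (auto simp: C_def)
  have glue: "?glue u k \<in> digits N k" if "u \<in> C" "k \<in> {1..n}" for u k
    using that w C by (cases "k \<le> m") (auto simp: PiE_def Pi_def)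
  have c: "0 < cyl_len w m" using w by (rule cyl_len_pos)
  have g_cong: "cyl_len (?g u) n = cyl_len (?glue u) n" "cylinder q (?g u) n = cylinder q (?glue u) n" for u
    by (rule cyl_cong cylinder_cong; simp)+
  have inj: "inj_on ?g C"
  proof (rule inj_onI)
    fix u v assume uv: "u \<in> C" "v \<in> C" "?g u = ?g v"
    have "u k = v k" if "k \<in> ?I" for k
      using fun_cong[OF uv(3), of k] that by (auto split: if_splits)
    then show "u = v"
      using uv C by (intro PiE_ext[of u ?I "digits N" v]) auto
  qed
  have gC: "?g ` C \<subseteq> PiE {1..n} (digits N)"
    using glue by auto

  have Q_small: "infsum (Q_word ?I) C \<le> \<delta>"
  proof -
    have "(\<Sum>\<^sub>\<infinity>v\<in>?g ` C. cyl_len v n) = (\<Sum>\<^sub>\<infinity>u\<in>C. cyl_len (?g u) n)"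
      using infsum_reindex[OF inj, of "\<lambda>v. cyl_len v n"] by (simp only: comp_def)
    also have "\<dots> = (\<Sum>\<^sub>\<infinity>u\<in>C. cyl_len w m * Q_word ?I u)"
      by (simp only: g_cong prod_glue[of "\<lambda>i k. q i k"])
    also have "\<dots> = cyl_len w m * infsum (Q_word ?I) C"
      by (rule infsum_cmult_right')
    finally have eq: "(\<Sum>\<^sub>\<infinity>v\<in>?g ` C. cyl_len v n) = cyl_len w m * infsum (Q_word ?I) C" .
    have "ennreal (\<Sum>\<^sub>\<infinity>v\<in>?g ` C. cyl_len v n) \<le> emeasure lborel U"
      using gC U(1)
    proof (rule cyl_len_sum_le_emeasure)
      fix v assume "v \<in> ?g ` C"
      then show "cylinder q v n \<subseteq> U" using g_cong(2) by (auto simp: C_def)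
    qed
    also note U(2)
    finally have "cyl_len w m * infsum (Q_word ?I) C \<le> \<delta> * cyl_len w m"
      unfolding eq using \<delta> c by (subst (asm) ennreal_le_iff) auto
    then show ?thesis using c by (simp add: mult.commute)
  qed

  have P_small: "infsum (P_word ?I) C \<le> 1 - (r - sqrt \<delta>)\<^sup>2"
  proof -
    have "r \<le> sqrt (infsum (Q_word ?I) C) + sqrt (1 - infsum (P_word ?I) C)"
      using r affinity_le[OF I C] by simp
    also have "sqrt (infsum (Q_word ?I) C) \<le> sqrt \<delta>"
      using Q_small by simp
    finally have "r - sqrt \<delta> \<le> sqrt (1 - infsum (P_word ?I) C)" by simp
    moreover have "infsum (P_word ?I) C \<le> 1"
      using infsumI[OF prob_word_event[OF I C]] by simp
    ultimately have "(r - sqrt \<delta>)\<^sup>2 \<le> 1 - infsum (P_word ?I) C"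
      using power_mono[of "r - sqrt \<delta>" "sqrt (1 - infsum (P_word ?I) C)" 2] \<delta> by simp
    then show ?thesis by simp
  qed

  have "prob (agree {1..m} w \<inter> agree ?I u) = prob (agree {1..m} w) * P_word ?I u" if "u \<in> C" for u
  proof -
    have "agree {1..m} (?glue u) = agree {1..m} w" "agree ?I (?glue u) = agree ?I u"
      by (simp_all add: agree_def)
    moreover have "agree {1..n} (?glue u) = agree {1..m} (?glue u) \<inter> agree ?I (?glue u)"
      unfolding split agree_def by blast
    ultimately have "agree {1..m} w \<inter> agree ?I u = agree {1..n} (?glue u)"
      by simp
    also have "prob \<dots> = (\<Prod>k=1..n. p (?glue u k) k)"
      using glue[OF that] by (intro prob_agree) auto
    also have "\<dots> = (\<Prod>k=1..m. p (w k) k) * P_word ?I u"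
      by (rule prod_glue)
    also have "(\<Prod>k=1..m. p (w k) k) = prob (agree {1..m} w)"
      using w by (intro prob_agree[symmetric]) auto
    finally show ?thesis .
  qed
  then have "(\<Sum>\<^sub>\<infinity>u\<in>C. prob (agree {1..m} w \<inter> agree ?I u)) =
      (\<Sum>\<^sub>\<infinity>u\<in>C. prob (agree {1..m} w) * P_word ?I u)"
    by (rule infsum_cong)
  moreover have "agree {1..m} w \<in> events" by (rule agree_event) auto
  ultimately have "prob (agree {1..m} w \<inter> word_event ?I C) = prob (agree {1..m} w) * infsum (P_word ?I) C"
    using infsumI[OF prob_split_words[OF I C]] by (simp add: infsum_cmult_right')
  then show ?thesis
    using P_small by (simp add: mult_left_mono)
qed

text \<open>
  A null set has open supersets \<open>U\<close> of arbitrarily small length, also compared with the cylinder of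
  \<open>w\<close>. A random number in \<open>U\<close> has a cylinder inside \<open>U\<close> from some rank on, so continuity from below
  transfers the uniform bound on finite words to the null set.
\<close>

lemma prob_prefix_null_le:
  assumes A: "A \<in> sets borel" "emeasure lborel A = 0" and w: "word m w"
    and r: "0 < r" "\<And>n. m \<le> n \<Longrightarrow> r \<le> (\<Prod>k\<in>{m<..n}. affinity k)"
  shows "prob ({\<omega> \<in> space M. val \<omega> \<in> A} \<inter> agree {1..m} w) \<le> prob (agree {1..m} w) * (1 - r\<^sup>2)"
proof -
  let ?E = "agree {1..m} w"
  have [measurable]: "val \<in> borel_measurable M" by (rule measurable_val)
  have E: "?E \<in> events" by (rule agree_event) auto
  have c: "0 < cyl_len w m" using w by (rule cyl_len_pos)
  have *: "prob ({\<omega> \<in> space M. val \<omega> \<in> A} \<inter> ?E) \<le> prob ?E * (1 - (r - s)\<^sup>2)"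
    if s: "0 < s" "s \<le> r" for s
  proof -
    have pos: "0 < s\<^sup>2 * cyl_len w m" using s c by simp
    \<comment> \<open>The relative length \<open>s\<^sup>2\<close> makes the loss in the affinity bound equal to \<open>s\<close>.\<close>
    obtain U where U: "open U" "A \<subseteq> U" "emeasure lborel (U - A) < ennreal (s\<^sup>2 * cyl_len w m)"
      using outer_regular_lborel[OF A(1) pos] .
    have "emeasure lborel U = emeasure lborel (U - A)"
      using A U(1) by (intro emeasure_Diff_null_set[symmetric]) (auto simp: null_sets_def)
    then have U_small: "emeasure lborel U \<le> ennreal (s\<^sup>2 * cyl_len w m)"
      using U(3) by simp
    have U_borel: "U \<in> sets borel" using U(1) by simp
    define C where "C n = {u \<in> PiE {m<..n} (digits N).
      cylinder q (\<lambda>k. if k \<le> m then w k else u k) n \<subseteq> U}" for n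
    define G where "G j = ?E \<inter> word_event {m<..m + j} (C (m + j))" for j
    have G_le: "prob (G j) \<le> prob ?E * (1 - (r - s)\<^sup>2)" for j
      unfolding G_def C_def
      using prob_prefix_open_le[OF w le_add1 r(2)[OF le_add1] U_borel U_small] s by simp
    have G_iff: "\<omega> \<in> G j \<longleftrightarrow> \<omega> \<in> ?E \<and> cylinder q (\<lambda>k. \<xi> k \<omega>) (m + j) \<subseteq> U" for \<omega> j
    proof -
      have "\<omega> \<in> word_event {m<..m + j} (C (m + j)) \<longleftrightarrow> cylinder q (\<lambda>k. \<xi> k \<omega>) (m + j) \<subseteq> U"
        if \<omega>: "\<omega> \<in> ?E"
      proof -
        let ?u = "restrict (\<lambda>k. \<xi> k \<omega>) {m<..m + j}"
        have sp: "\<omega> \<in> space M" using \<omega> by (simp add: agree_def)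
        have "cylinder q (\<lambda>k. if k \<le> m then w k else ?u k) (m + j) = cylinder q (\<lambda>k. \<xi> k \<omega>) (m + j)"
          using \<omega> by (intro cylinder_cong) (simp add: agree_def)
        moreover have "?u \<in> PiE {m<..m + j} (digits N)"
          using digit_in sp by auto
        ultimately show ?thesis
          using sp unfolding word_event_def C_def by simp
      qed
      then show ?thesis unfolding G_def by blast
    qed
    have G_events: "G j \<in> events" for j
      unfolding G_def using E by (intro sets.Int word_event_event) (auto simp: C_def)
    have "incseq G"
    proof (intro incseq_SucI subsetI)
      fix j \<omega> assume \<omega>: "\<omega> \<in> G j"
      then have "\<omega> \<in> space M" by (simp add: G_iff agree_def)
      then have wd: "word n (\<lambda>k. \<xi> k \<omega>)" for n using digit_in by auto
      have "cylinder q (\<lambda>k. \<xi> k \<omega>) (m + Suc j) \<subseteq> cylinder q (\<lambda>k. \<xi> k \<omega>) (m + j)"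
        using cyl_nested[OF _ wd, of "m + j" "m + Suc j"] by (auto simp: cylinder_def)
      then show "\<omega> \<in> G (Suc j)" using \<omega> unfolding G_iff by blast
    qed
    then have "(\<lambda>j. prob (G j)) \<longlonglongrightarrow> prob (\<Union>j. G j)"
      using G_events by (intro finite_Lim_measure_incseq) auto
    then have UN_le: "prob (\<Union>j. G j) \<le> prob ?E * (1 - (r - s)\<^sup>2)"
      by (rule LIMSEQ_le_const2) (use G_le in blast)
    have "{\<omega> \<in> space M. val \<omega> \<in> A} \<inter> ?E \<subseteq> (\<Union>j. G j)"
    proof
      fix \<omega> assume \<omega>: "\<omega> \<in> {\<omega> \<in> space M. val \<omega> \<in> A} \<inter> ?E"
      then have sp: "\<omega> \<in> space M" and "val \<omega> \<in> U" using U(2) by auto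
      then obtain e where e: "0 < e" "ball (val \<omega>) e \<subseteq> U"
        using U(1) openE by blast
      have "(\<lambda>n. cyl_len (\<lambda>k. \<xi> k \<omega>) n) \<longlonglongrightarrow> 0"
        using digit_in sp by (intro cyl_len_tendsto_0) auto
      then have "\<forall>\<^sub>F n in sequentially. cyl_len (\<lambda>k. \<xi> k \<omega>) n < e"
        using e(1) by (rule order_tendstoD)
      then obtain n0 where "\<And>n. n0 \<le> n \<Longrightarrow> cyl_len (\<lambda>k. \<xi> k \<omega>) n < e"
        by (auto simp: eventually_sequentially)
      then have "cyl_len (\<lambda>k. \<xi> k \<omega>) (m + n0) < e" by simp
      then have "cylinder q (\<lambda>k. \<xi> k \<omega>) (m + n0) \<subseteq> ball (val \<omega>) e"
        using val_in_cylinder[OF sp, of "m + n0"] by (auto simp: cylinder_def dist_real_def)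
      then have "\<omega> \<in> G n0" using \<omega> e(2) unfolding G_iff by blast
      then show "\<omega> \<in> (\<Union>j. G j)" by blast
    qed
    then have "prob ({\<omega> \<in> space M. val \<omega> \<in> A} \<inter> ?E) \<le> prob (\<Union>j. G j)"
      using G_events by (intro finite_measure_mono) auto
    then show ?thesis using UN_le by simp
  qed
  have "((\<lambda>s. prob ?E * (1 - (r - s)\<^sup>2)) \<longlongrightarrow> prob ?E * (1 - (r - 0)\<^sup>2)) (at_right 0)"
    by (intro tendsto_intros)
  moreover have "\<forall>\<^sub>F s in at_right 0. prob ({\<omega> \<in> space M. val \<omega> \<in> A} \<inter> ?E) \<le> prob ?E * (1 - (r - s)\<^sup>2)"
    unfolding eventually_at_right_field using r(1) * by (intro exI[of _ r]) auto
  ultimately have "prob ({\<omega> \<in> space M. val \<omega> \<in> A} \<inter> ?E) \<le> prob ?E * (1 - (r - 0)\<^sup>2)"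
    by (rule tendsto_lowerbound) simp
  then show ?thesis by simp
qed

text \<open>
  Averaging the conditional bound over the first \<open>m\<close> digits leaves \<open>1 - r\<^sup>2\<close>, where
  \<open>r\<close> is the affinity of the digits after the \<open>m\<close>-th one.
\<close>

lemma prob_null_set:
  assumes pos: "0 < inf_product affinity" and A: "A \<in> sets borel" "emeasure lborel A = 0"
  shows "prob {\<omega> \<in> space M. val \<omega> \<in> A} = 0"
proof -
  define r where "r m = inf_product affinity / (\<Prod>k=1..m. affinity k)" for m
  have r: "r \<longlonglongrightarrow> 1" "0 < r m" "m \<le> n \<Longrightarrow> r m \<le> (\<Prod>k\<in>{m<..n}. affinity k)" for m n
    using inf_product_tail[OF affinity_sum(2) pos] unfolding r_def by blast+
  let ?V = "{\<omega> \<in> space M. val \<omega> \<in> A}"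
  have V: "?V \<in> events"
    using measurable_val A(1) by measurable
  have "prob ?V \<le> 1 - (r m)\<^sup>2" for m
  proof -
    let ?W = "PiE {1..m} (digits N)"
    have I: "finite {1..m}" "{1..m} \<subseteq> {1..}" by auto
    have sub: "X \<subseteq> space M" if "X \<in> events" for X
      using that by (rule sets.sets_into_space)
    have S: "((\<lambda>w. prob (?V \<inter> agree {1..m} w)) has_sum prob ?V) ?W"
      using prob_split_words[OF I order.refl V] word_event_all[OF I(2)] sub[OF V]
      by (simp add: Int_absorb2)
    have T: "((\<lambda>w. prob (agree {1..m} w)) has_sum 1) ?W"
      using prob_split_words[OF I order.refl sets.top] word_event_all[OF I(2)]
        sub[OF agree_event[OF I(2)]]
      by (simp add: Int_absorb1 prob_space)
    have "((\<lambda>w. prob (agree {1..m} w) * (1 - (r m)\<^sup>2)) has_sum 1 * (1 - (r m)\<^sup>2)) ?W"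
      using T by (rule has_sum_cmult_left)
    moreover have "prob (?V \<inter> agree {1..m} w) \<le> prob (agree {1..m} w) * (1 - (r m)\<^sup>2)" if "w \<in> ?W" for w
      using that by (intro prob_prefix_null_le A r) auto
    ultimately show ?thesis
      using has_sum_mono[OF S] by simp
  qed
  moreover have "(\<lambda>m. 1 - (r m)\<^sup>2) \<longlonglongrightarrow> 1 - 1\<^sup>2"
    by (intro tendsto_intros r)
  ultimately have "prob ?V \<le> 1 - 1\<^sup>2"
    by (intro LIMSEQ_le_const) auto
  then show ?thesis by (simp add: measure_le_0_iff)
qed

subsection \<open>The distribution of the random number\<close>

definition law :: "real measure" where
  "law = distr M borel val"

lemma sets_law: "sets law = sets borel"
  by (simp add: law_def)

lemma prob_space_law: "prob_space law"
  unfolding law_def using measurable_val by (rule prob_space_distr)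

lemma emeasure_law: "A \<in> sets borel \<Longrightarrow> emeasure law A = ennreal (prob {\<omega> \<in> space M. val \<omega> \<in> A})"
  unfolding law_def using measurable_val
  by (simp add: emeasure_distr emeasure_eq_measure vimage_def Int_def conj_commute)

lemma law_abs_continuous:
  assumes "0 < inf_product affinity"
  shows "purely_abs_continuous law"
  using prob_null_set[OF assms] emeasure_law
  by (auto simp: purely_abs_continuous_def absolutely_continuous_def null_sets_def sets_law)

lemma law_point:
  assumes "0 < inf_product p_max"
  shows "purely_point law"
proof -
  obtain C where C: "countable C" "prob {\<omega> \<in> space M. val \<omega> \<in> C} = 1"
    using countably_many_values[OF assms] by blast
  have borel: "C \<in> sets borel"
    using C(1) by (rule sets.countable[rotated]) auto
  interpret law: prob_space law by (rule prob_space_law)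
  have "emeasure law C = 1"
    using C borel by (simp add: emeasure_law)
  then have "emeasure law (space law - C) = 0"
    using borel sets_law by (subst emeasure_compl) (auto simp: law.emeasure_space_1)
  then show ?thesis
    using C(1) sets_eq_imp_space_eq[OF sets_law] unfolding purely_point_def by auto
qed

lemma law_singular_continuous:
  assumes "inf_product affinity = 0" "inf_product p_max = 0"
  shows "purely_singular_continuous law"
proof -
  have "emeasure law {x} = 0" for x
    using atomless[OF assms(2)] by (simp add: emeasure_law)
  moreover have "\<exists>A\<in>sets borel. emeasure lborel A = 0 \<and> emeasure law (UNIV - A) = 0"
  proof (rule singular_if_nearly_singular)
    show "finite_measure law"
      using prob_space_law by (rule prob_space.finite_measure)
    fix e :: real assume "0 < e"
    then obtain A where A: "A \<in> sets borel" "emeasure lborel A \<le> ennreal e"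
        "prob {\<omega> \<in> space M. val \<omega> \<notin> A} \<le> e"
      using nearly_singular[OF assms(1)] by blast
    have "emeasure law (UNIV - A) \<le> ennreal e"
      using A by (simp add: emeasure_law ennreal_leI)
    then show "\<exists>A\<in>sets borel. emeasure lborel A \<le> ennreal e \<and> emeasure law (UNIV - A) \<le> ennreal e"
      using A by blast
  qed (rule sets_law)
  ultimately show ?thesis
    unfolding purely_singular_continuous_def by blast
qed

text \<open>
  Each of the implications above covers one case of the two products, the cases are exhaustive, and
  the types exclude each other; hence every implication can be reversed.
\<close>

lemma law_pure_type:
  shows "purely_abs_continuous law \<or> purely_point law \<or> purely_singular_continuous law"
    and "purely_abs_continuous law \<longleftrightarrow> 0 < inf_product affinity"
    and "purely_point law \<longleftrightarrow> 0 < inf_product p_max"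
    and "purely_singular_continuous law \<longleftrightarrow> inf_product affinity = 0 \<and> inf_product p_max = 0"
proof -
  note excl = pure_types_exclusive[OF prob_space_law sets_law]
  have "0 \<le> inf_product affinity" "0 \<le> inf_product p_max"
    using inf_product_lim(3) affinity_sum(2) p_max_01 by auto
  then have sc: "purely_singular_continuous law"
    if "\<not> 0 < inf_product affinity" "\<not> 0 < inf_product p_max"
    using that law_singular_continuous by simp
  show "purely_abs_continuous law \<or> purely_point law \<or> purely_singular_continuous law"
    using law_abs_continuous law_point sc by blast
  show "purely_abs_continuous law \<longleftrightarrow> 0 < inf_product affinity"
    using law_abs_continuous law_point sc excl by blast
  show "purely_point law \<longleftrightarrow> 0 < inf_product p_max"
    using law_abs_continuous law_point sc excl by blast
  show "purely_singular_continuous law \<longleftrightarrow> inf_product affinity = 0 \<and> inf_product p_max = 0"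
    using law_abs_continuous law_point law_singular_continuous excl
      \<open>0 \<le> inf_product affinity\<close> \<open>0 \<le> inf_product p_max\<close>
    by (metis less_eq_real_def)
qed

end

theorem theorem2:
  fixes N :: "nat \<Rightarrow> enat"
    and q p :: "nat \<Rightarrow> nat \<Rightarrow> real"
    and M :: "'a measure"
    and \<xi> :: "nat \<Rightarrow> 'a \<Rightarrow> nat"
    and \<mu> :: "real measure"
    and \<rho> P_max :: real
  assumes Q: "Q_matrix N q"
    and p_nonneg: "\<And>k i. k \<ge> 1 \<Longrightarrow> i \<in> digits N k \<Longrightarrow> p i k \<ge> 0"
    and p_sum: "\<And>k. k \<ge> 1 \<Longrightarrow> ((\<lambda>i. p i k) has_sum 1) (digits N k)"
    and M: "prob_space M"
    and indep: "prob_space.indep_vars M (\<lambda>k. count_space (digits N k)) \<xi> {1..}"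
    and distr: "\<And>k i. k \<ge> 1 \<Longrightarrow> i \<in> digits N k \<Longrightarrow>
                  measure M {\<omega> \<in> space M. \<xi> k \<omega> = i} = p i k"
    and \<mu>: "\<mu> = distr M borel (\<lambda>\<omega>. Delta q (\<lambda>k. \<xi> k \<omega>))"
    and \<rho>: "\<rho> = inf_product (\<lambda>k. \<Sum>\<^sub>\<infinity>i\<in>digits N k. sqrt (p i k * q i k))"
    and P_max: "P_max = inf_product (\<lambda>k. col_max (digits N k) (\<lambda>i. p i k))"
  shows "(purely_abs_continuous \<mu> \<or> purely_point \<mu> \<or> purely_singular_continuous \<mu>) \<and>
         (purely_abs_continuous \<mu> \<longleftrightarrow> \<rho> > 0) \<and>
         (purely_point \<mu> \<longleftrightarrow> P_max > 0) \<and>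
         (purely_singular_continuous \<mu> \<longleftrightarrow> \<rho> = 0 \<and> P_max = 0)"
proof -
  interpret prob_space M by fact
  interpret random_digits N q M p \<xi>
    by unfold_locales (use Q p_nonneg p_sum indep distr in auto)
  have "\<mu> = law"
    unfolding \<mu> law_def ..
  moreover have "\<rho> = inf_product affinity"
    unfolding \<rho> affinity_def ..
  ultimately show ?thesis
    using law_pure_type by (simp only: P_max simp_thms)
qed

end
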